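(* Let $\{(y_t,X_t)\}_{t=1}^n\subset\mathbb R\times\mathbb R^p$ and let $\lambda,\zeta>0$ be arbitrary. For the algorithm $\mathrm{DPDU}(\{(y_t,X_t)\}_{t=1}^n,\lambda,\zeta)$ (defined in the context), the memory cost is $O(n+p^2)$ and the computational cost is $O(n^2p^2+n^2\,\mathbf{Lasso}(p))$, where $\mathbf{Lasso}(p)$ denotes the computational cost of computing the Lasso estimator on an interval $\mathcal I$ once the sums $\sum_{t\in\mathcal I}y_tX_t\in\mathbb R^p$ and $\sum_{t\in\mathcal I}X_tX_t^\top\in\mathbb R^{p\times p}$ are given.
   Context: Algorithm DPDU (dynamic programming with dynamic update). Input: data $\{(y_t,X_t)\}_{t=1}^n$, tuning parameters $\lambda,\zeta>0$. Initialise $\widehat{\mathcal B}\leftarrow\varnothing$, a pointer vector $\mathfrak p$ with all entries $-1$, and $B=(B_1,\dots,B_{n+1})\leftarrow(-\zeta,\infty,\dots,\infty)$. For $r=2,\dots,n+1$: set $\mathcal M\leftarrow 0\in\mathbb R^{p\times p}$, $\mathcal V\leftarrow 0\in\mathbb R^p$ (row vector). For $l=r-1,r-2,\dots,1$ (in this order): (1) $\mathcal M\leftarrow\mathcal M+X_lX_l^\top$, $\mathcal V\leftarrow\mathcal V+y_lX_l^\top$; let $\mathcal I=[l,r)\cap\mathbb Z$. (2) If $|\mathcal I|\ge\zeta$, compute $\widehat\beta_{\mathcal I}\leftarrow\arg\min_{\beta\in\mathbb R^p}|\mathcal I|^{-1}\{-2\mathcal V\beta+\beta^\top\mathcal M\beta\}+\lambda|\mathcal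 I|^{-1/2}|\beta|_1$ (the Lasso step, of cost $\mathbf{Lasso}(p)$) and $\mathcal G(\mathcal I)\leftarrow-2\mathcal V\widehat\beta_{\mathcal I}+\widehat\beta_{\mathcal I}^\top\mathcal M\widehat\beta_{\mathcal I}$; otherwise $\mathcal G(\mathcal I)\leftarrow0$. (3) $b\leftarrow B_l+\zeta+\mathcal G(\mathcal I)$; if $b<B_r$, then $B_r\leftarrow b$ and $\mathfrak p_r\leftarrow l$. Afterwards backtrack: $k\leftarrow n+1$; while $k>1$: $h\leftarrow\mathfrak p_k$, $\widehat{\mathcal B}\leftarrow\widehat{\mathcal B}\cup\{h\}$, $k\leftarrow h$. Output the resulting partition points $\widehat{\mathcal B}$ (together with their number and the associated Lasso estimators). Computational cost is the number of arithmetic operations. Memory cost counts the quantities stored by the algorithm besides the input data: the current $\mathcal M$, $\mathcal V$, the vectors $B$, $\mathfrak p$, the set $\widehat{\mathcal B}$, and temporary quantities of the current step. *)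

theory Defs
  imports "Jordan_Normal_Form.Matrix" "HOL-Library.Extended_Real"
begin

section \<open>The Lasso problem and Lasso solvers\<close>

text \<open>The sums over \<open>I\<close> of \<open>y\<^sub>t X\<^sub>t\<close> and of \<open>X\<^sub>t X\<^sub>t\<^sup>T\<close>; coordinates are numbered from 0.\<close>

definition cross_sum :: "nat \<Rightarrow> (nat \<Rightarrow> real) \<Rightarrow> (nat \<Rightarrow> real vec) \<Rightarrow> nat set \<Rightarrow> real vec" where
  "cross_sum p y X I = vec p (\<lambda>i. \<Sum>t\<in>I. y t * X t $ i)"

definition gram_sum :: "nat \<Rightarrow> (nat \<Rightarrow> real vec) \<Rightarrow> nat set \<Rightarrow> real mat" where
  "gram_sum p X I = mat p p (\<lambda>(i, j). \<Sum>t\<in>I. X t $ i * X t $ j)"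

definition lasso_objective :: "nat \<Rightarrow> real \<Rightarrow> real vec \<Rightarrow> real mat \<Rightarrow> real vec \<Rightarrow> real" where
  "lasso_objective m lam V M \<beta> =
     (- 2 * (V \<bullet> \<beta>) + \<beta> \<bullet> (M *\<^sub>v \<beta>)) / real m
     + lam / sqrt (real m) * (\<Sum>i<dim_vec \<beta>. \<bar>\<beta> $ i\<bar>)"

definition is_lasso_estimator ::
  "nat \<Rightarrow> nat \<Rightarrow> real \<Rightarrow> real vec \<Rightarrow> real mat \<Rightarrow> real vec \<Rightarrow> bool" where
  "is_lasso_estimator p m lam V M \<beta> \<longleftrightarrow>
     is_arg_min (lasso_objective m lam V M) (\<lambda>b. b \<in> carrier_vec p) \<beta>"

text \<open>A call of a solver returns the estimate, and reports the number of arithmetic operations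
  and the number of auxiliary storage cells it used.\<close>

record lasso_run =
  estimate :: "real vec"
  flops :: nat
  workspace :: nat

text \<open>Arguments: interval length, penalty, and the two sums.\<close>

type_synonym solver = "nat \<Rightarrow> real \<Rightarrow> real vec \<Rightarrow> real mat \<Rightarrow> lasso_run"

text \<open>\<open>Lasso p\<close> bounds the cost of computing a Lasso estimator on any interval from the two sums.
  The minimiser need not be unique, and a solver may return any of them.  The auxiliary storage of
  a call is at most \<open>K p\<^sup>2\<close> cells, the order of the storage of its matrix argument.\<close>

definition lasso_procedure :: "solver \<Rightarrow> (nat \<Rightarrow> nat) \<Rightarrow> nat \<Rightarrow> bool" where
  "lasso_procedure S Lasso K \<longleftrightarrow>
     (\<forall>p y X l r lam. 1 \<le> p \<and> 0 < lam \<and> l < r \<and> (\<forall>t\<in>{l..<r}. X t \<in> carrier_vec p) \<longrightarrow>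
       (let V = cross_sum p y X {l..<r};
            M = gram_sum p X {l..<r};
            run = S (r - l) lam V M
        in is_lasso_estimator p (r - l) lam V M (estimate run)
           \<and> flops run \<le> Lasso p
           \<and> workspace run \<le> K * p\<^sup>2))"


section \<open>A random access machine over the extended reals\<close>

text \<open>A cell \<open>Loc x is\<close> holds the entry of the array \<open>x\<close> with indices \<open>is\<close>; scalars have no index.
  \<open>Tmp\<close> cells hold the intermediate results of expressions, \<open>Work\<close> cells are the auxiliary
  storage of the Lasso solver.  Extended reals are needed only for the initial value \<open>\<infinity>\<close>.\<close>

datatype addr = Loc string "nat list" | Tmp nat | Work nat

type_synonym heap = "addr \<Rightarrow> ereal"

datatype expr =
    Const ereal
  | Cell string "expr list"
  | Add expr expr  (infixl "\<^bold>+" 65)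
  | Sub expr expr  (infixl "\<^bold>-" 65)
  | Mul expr expr  (infixl "\<^bold>*" 70)

abbreviation Var :: "string \<Rightarrow> expr" where
  "Var x \<equiv> Cell x []"

definition index :: "ereal \<Rightarrow> nat" where
  "index v = nat \<lfloor>real_of_ereal v\<rfloor>"

fun eval :: "expr \<Rightarrow> heap \<Rightarrow> ereal" where
  "eval (Const c) h = c"
| "eval (Cell x es) h = h (Loc x (map (\<lambda>e. index (eval e h)) es))"
| "eval (a \<^bold>+ b) h = eval a h + eval b h"
| "eval (a \<^bold>- b) h = eval a h - eval b h"
| "eval (a \<^bold>* b) h = eval a h * eval b h"

text \<open>Arithmetic on array indices and loop counters is counted like any other arithmetic.\<close>

fun nops :: "expr \<Rightarrow> nat" where
  "nops (Const c) = 0"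
| "nops (Cell x es) = (\<Sum>e\<leftarrow>es. nops e)"
| "nops (a \<^bold>+ b) = nops a + nops b + 1"
| "nops (a \<^bold>- b) = nops a + nops b + 1"
| "nops (a \<^bold>* b) = nops a + nops b + 1"

datatype cond = Less expr expr | Leq expr expr

fun holds :: "cond \<Rightarrow> heap \<Rightarrow> bool" where
  "holds (Less a b) h \<longleftrightarrow> eval a h < eval b h"
| "holds (Leq a b) h \<longleftrightarrow> eval a h \<le> eval b h"

fun cond_ops :: "cond \<Rightarrow> nat" where
  "cond_ops (Less a b) = nops a + nops b + 1"
| "cond_ops (Leq a b) = nops a + nops b + 1"

text \<open>\<open>LASSO p m lam V M \<beta>\<close> calls the solver on the arrays \<open>V\<close> and \<open>M\<close> and stores the
  estimate in the array \<open>\<beta>\<close>; the cells \<open>Work\<close> it uses are never read by the program, so only their number is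
  modelled.  \<open>PRINT\<close> writes to a write-only output tape.\<close>

datatype com =
    SKIP
  | Assign string "expr list" expr  ("_\<^bold>[_\<^bold>] ::= _" [1000, 0, 61] 61)
  | Seq com com  (infixr ";;" 60)
  | If cond com com  ("(IF _/ THEN _/ ELSE _)" [0, 0, 61] 61)
  | While cond com  ("(WHILE _/ DO _)" [0, 61] 61)
  | LASSO expr expr expr string string string
  | PRINT expr

abbreviation Set :: "string \<Rightarrow> expr \<Rightarrow> com"  ("_ ::= _" [1000, 61] 61) where
  "x ::= e \<equiv> Assign x [] e"

definition read_vec :: "nat \<Rightarrow> string \<Rightarrow> heap \<Rightarrow> real vec" where
  "read_vec p x h = vec p (\<lambda>i. real_of_ereal (h (Loc x [i])))"

definition read_mat :: "nat \<Rightarrow> string \<Rightarrow> heap \<Rightarrow> real mat" where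
  "read_mat p x h = mat p p (\<lambda>(i, j). real_of_ereal (h (Loc x [i, j])))"

definition write_vec :: "nat \<Rightarrow> string \<Rightarrow> real vec \<Rightarrow> heap \<Rightarrow> heap" where
  "write_vec p x v h a =
     (if \<exists>i<p. a = Loc x [i] then ereal (v $ (THE i. a = Loc x [i])) else h a)"

definition tmps :: "nat \<Rightarrow> addr set" where
  "tmps k = Tmp ` {..<k}"

text \<open>\<open>exec S c h h' out t W\<close>: with solver \<open>S\<close>, the command \<open>c\<close> started in \<open>h\<close> terminates in \<open>h'\<close>,
  prints \<open>out\<close>, performs \<open>t\<close> arithmetic operations (comparisons included), and \<open>W\<close> is the set of
  cells it writes.  So \<open>card W\<close> is the number of cells in use besides the read-only input.\<close>

inductive exec ::
  "solver \<Rightarrow> com \<Rightarrow> heap \<Rightarrow> heap \<Rightarrow> ereal list \<Rightarrow> nat \<Rightarrow> addr set \<Rightarrow> bool"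
  for S :: solver where
  Skip: "exec S SKIP h h [] 0 {}"
| Assign:
    "a = Loc x (map (\<lambda>i. index (eval i h)) es) \<Longrightarrow> k = (\<Sum>i\<leftarrow>es. nops i) + nops e \<Longrightarrow>
     exec S (Assign x es e) h (h(a := eval e h)) [] k (insert a (tmps k))"
| Seq:
    "exec S c1 h h' out1 t1 W1 \<Longrightarrow> exec S c2 h' h'' out2 t2 W2 \<Longrightarrow>
     exec S (c1;; c2) h h'' (out1 @ out2) (t1 + t2) (W1 \<union> W2)"
| IfTrue:
    "holds b h \<Longrightarrow> exec S c1 h h' out t W \<Longrightarrow>
     exec S (IF b THEN c1 ELSE c2) h h' out (cond_ops b + t) (tmps (cond_ops b) \<union> W)"
| IfFalse:
    "\<not> holds b h \<Longrightarrow> exec S c2 h h' out t W \<Longrightarrow>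
     exec S (IF b THEN c1 ELSE c2) h h' out (cond_ops b + t) (tmps (cond_ops b) \<union> W)"
| WhileFalse:
    "\<not> holds b h \<Longrightarrow>
     exec S (WHILE b DO c) h h [] (cond_ops b) (tmps (cond_ops b))"
| WhileTrue:
    "holds b h \<Longrightarrow> exec S c h h' out1 t1 W1 \<Longrightarrow> exec S (WHILE b DO c) h' h'' out2 t2 W2 \<Longrightarrow>
     exec S (WHILE b DO c) h h'' (out1 @ out2) (cond_ops b + t1 + t2)
       (tmps (cond_ops b) \<union> W1 \<union> W2)"
| Lasso:
    "p = index (eval ep h) \<Longrightarrow>
     run = S (index (eval em h)) (real_of_ereal (eval el h)) (read_vec p v h) (read_mat p w h) \<Longrightarrow>
     k = nops ep + nops em + nops el \<Longrightarrow>
     exec S (LASSO ep em el v w x) h (write_vec p x (estimate run) h) [] (k + flops run)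
       (tmps k \<union> (\<lambda>i. Loc x [i]) ` {..<p} \<union> Work ` {..<workspace run})"
| Print: "exec S (PRINT e) h h [eval e h] (nops e) (tmps (nops e))"

inductive_cases SkipE: "exec S SKIP h h' out t W"
inductive_cases AssignE: "exec S (Assign x es e) h h' out t W"
inductive_cases SeqE: "exec S (c1;; c2) h h' out t W"
inductive_cases IfE: "exec S (IF b THEN c1 ELSE c2) h h' out t W"
inductive_cases WhileE: "exec S (WHILE b DO c) h h' out t W"
inductive_cases LassoE: "exec S (LASSO ep em el v w x) h h' out t W"
inductive_cases PrintE: "exec S (PRINT e) h h' out t W"

lemma exec_deterministic:
  assumes "exec S c h h1 out1 t1 W1" and "exec S c h h2 out2 t2 W2"
  shows "h1 = h2 \<and> out1 = out2 \<and> t1 = t2 \<and> W1 = W2"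
  using assms
proof (induction arbitrary: h2 out2 t2 W2 rule: exec.induct)
  case Skip
  then show ?case by (auto elim: SkipE)
next
  case Assign
  then show ?case by (auto elim: AssignE)
next
  case (Seq c1 h h' o1 t1 W1 c2 h'' o2 t2 W2)
  from Seq.prems show ?case by (rule SeqE) (use Seq.IH in blast)
next
  case (IfTrue b h c1 h' out t W c2)
  from IfTrue.prems show ?case by (rule IfE) (use IfTrue in blast)+
next
  case (IfFalse b h c2 h' out t W c1)
  from IfFalse.prems show ?case by (rule IfE) (use IfFalse in blast)+
next
  case (WhileFalse b h c)
  from WhileFalse.prems show ?case by (rule WhileE) (use WhileFalse in blast)+
next
  case (WhileTrue b h c h' o1 t1 W1 h'' o2 t2 W2)
  from WhileTrue.prems show ?case by (rule WhileE) (use WhileTrue in blast)+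
next
  case Lasso
  then show ?case by (auto elim!: LassoE)
next
  case Print
  then show ?case by (auto elim: PrintE)
qed

definition For :: "string \<Rightarrow> expr \<Rightarrow> expr \<Rightarrow> com \<Rightarrow> com"
    ("(FOR _ = _ TO _/ DO _)" [1000, 0, 0, 61] 61) where
  "FOR x = a TO b DO c =
     (x ::= a;; WHILE Leq (Var x) b DO (c;; x ::= Var x \<^bold>+ Const 1))"

definition ForDown :: "string \<Rightarrow> expr \<Rightarrow> expr \<Rightarrow> com \<Rightarrow> com"
    ("(FOR _ = _ DOWNTO _/ DO _)" [1000, 0, 0, 61] 61) where
  "FOR x = a DOWNTO b DO c =
     (x ::= a;; WHILE Leq b (Var x) DO (c;; x ::= Var x \<^bold>- Const 1))"


section \<open>The algorithm\<close>

definition reset_sums :: com where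
  "reset_sums =
    (FOR ''i'' = Const 0 TO Var ''p'' \<^bold>- Const 1 DO
      (''V''\<^bold>[[Var ''i'']\<^bold>] ::= Const 0;;
       FOR ''j'' = Const 0 TO Var ''p'' \<^bold>- Const 1 DO
         ''M''\<^bold>[[Var ''i'', Var ''j'']\<^bold>] ::= Const 0))"

definition update_sums :: com where
  "update_sums =
    (FOR ''i'' = Const 0 TO Var ''p'' \<^bold>- Const 1 DO
      (''V''\<^bold>[[Var ''i'']\<^bold>] ::=
          Cell ''V'' [Var ''i''] \<^bold>+ Cell ''y'' [Var ''l''] \<^bold>* Cell ''X'' [Var ''l'', Var ''i''];;
       FOR ''j'' = Const 0 TO Var ''p'' \<^bold>- Const 1 DO
         ''M''\<^bold>[[Var ''i'', Var ''j'']\<^bold>] ::=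
            Cell ''M'' [Var ''i'', Var ''j'']
            \<^bold>+ Cell ''X'' [Var ''l'', Var ''i''] \<^bold>* Cell ''X'' [Var ''l'', Var ''j'']))"

definition lasso_step :: com where
  "lasso_step = LASSO (Var ''p'') (Var ''m'') (Var ''lambda'') ''V'' ''M'' ''beta''"

definition loss_step :: com where
  "loss_step =
    (''lin'' ::= Const 0;;
     ''quad'' ::= Const 0;;
     FOR ''i'' = Const 0 TO Var ''p'' \<^bold>- Const 1 DO
      (''lin'' ::= Var ''lin'' \<^bold>+ Cell ''V'' [Var ''i''] \<^bold>* Cell ''beta'' [Var ''i''];;
       FOR ''j'' = Const 0 TO Var ''p'' \<^bold>- Const 1 DO
         ''quad'' ::= Var ''quad''
            \<^bold>+ Cell ''beta'' [Var ''i''] \<^bold>* Cell ''M'' [Var ''i'', Var ''j''] \<^bold>* Cell ''beta'' [Var ''j'']);;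
     ''G'' ::= Const (-2) \<^bold>* Var ''lin'' \<^bold>+ Var ''quad'')"

definition dp_init :: com where
  "dp_init =
    (''num'' ::= Const 0;;
     FOR ''r'' = Const 1 TO Var ''n'' \<^bold>+ Const 1 DO
      (''ptr''\<^bold>[[Var ''r'']\<^bold>] ::= Const (-1);;
       ''B''\<^bold>[[Var ''r'']\<^bold>] ::= Const \<infinity>);;
     ''B''\<^bold>[[Const 1]\<^bold>] ::= Const 0 \<^bold>- Var ''zeta'')"

definition dp_loop :: com where
  "dp_loop =
    (FOR ''r'' = Const 2 TO Var ''n'' \<^bold>+ Const 1 DO
      (reset_sums;;
       FOR ''l'' = Var ''r'' \<^bold>- Const 1 DOWNTO Const 1 DO
        (update_sums;;
         ''m'' ::= Var ''r'' \<^bold>- Var ''l'';;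
         (IF Leq (Var ''zeta'') (Var ''m'')
          THEN (lasso_step;; loss_step)
          ELSE ''G'' ::= Const 0);;
         ''b'' ::= Cell ''B'' [Var ''l''] \<^bold>+ Var ''zeta'' \<^bold>+ Var ''G'';;
         (IF Less (Var ''b'') (Cell ''B'' [Var ''r''])
          THEN (''B''\<^bold>[[Var ''r'']\<^bold>] ::= Var ''b'';; ''ptr''\<^bold>[[Var ''r'']\<^bold>] ::= Var ''l'')
          ELSE SKIP))))"

text \<open>The set of partition points is stored as the first \<open>num\<close> entries of the array \<open>Bhat\<close>.\<close>

definition backtrack :: com where
  "backtrack =
    (''k'' ::= Var ''n'' \<^bold>+ Const 1;;
     WHILE Less (Const 1) (Var ''k'') DO
      (''h'' ::= Cell ''ptr'' [Var ''k''];;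
       ''Bhat''\<^bold>[[Var ''num'']\<^bold>] ::= Var ''h'';;
       ''num'' ::= Var ''num'' \<^bold>+ Const 1;;
       ''k'' ::= Var ''h''))"

text \<open>The number of partition points, the points, and then for every interval of the partition, from
  right to left, its Lasso estimator.  The estimators are recomputed one at a time, because keeping
  all of them would take \<open>num * p\<close> cells.\<close>

definition print_result :: com where
  "print_result =
    (PRINT (Var ''num'');;
     FOR ''q'' = Const 0 TO Var ''num'' \<^bold>- Const 1 DO PRINT (Cell ''Bhat'' [Var ''q'']);;
     ''k'' ::= Var ''n'' \<^bold>+ Const 1;;
     FOR ''q'' = Const 0 TO Var ''num'' \<^bold>- Const 1 DO
      (''h'' ::= Cell ''Bhat'' [Var ''q''];;
       reset_sums;;
       FOR ''l'' = Var ''k'' \<^bold>- Const 1 DOWNTO Var ''h'' DO update_sums;;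
       ''m'' ::= Var ''k'' \<^bold>- Var ''h'';;
       lasso_step;;
       FOR ''i'' = Const 0 TO Var ''p'' \<^bold>- Const 1 DO PRINT (Cell ''beta'' [Var ''i'']);;
       ''k'' ::= Var ''h''))"

definition DPDU :: com where
  "DPDU = (dp_init;; dp_loop;; backtrack;; print_result)"

text \<open>All cells other than those of the input have arbitrary initial contents.\<close>

definition input_heap ::
  "nat \<Rightarrow> nat \<Rightarrow> (nat \<Rightarrow> real) \<Rightarrow> (nat \<Rightarrow> real vec) \<Rightarrow> real \<Rightarrow> real \<Rightarrow> heap \<Rightarrow> bool" where
  "input_heap n p y X lam zeta h \<longleftrightarrow>
     h (Loc ''n'' []) = ereal (real n) \<and>
     h (Loc ''p'' []) = ereal (real p) \<and>
     h (Loc ''lambda'' []) = ereal lam \<and>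
     h (Loc ''zeta'' []) = ereal zeta \<and>
     (\<forall>t\<in>{1..n}. h (Loc ''y'' [t]) = ereal (y t)) \<and>
     (\<forall>t\<in>{1..n}. \<forall>i<p. h (Loc ''X'' [t, i]) = ereal (X t $ i))"

end

theory Submission
  imports Defs
begin

text \<open>
  The body of the inner loop of the dynamic programme is executed at most \<open>n\<^sup>2\<close> times, and costs
  \<open>O(p\<^sup>2)\<close> operations for updating the two sums and evaluating the loss, plus one call of the solver.
  The bound on the cost of that call is available only if the arrays \<open>V\<close> and \<open>M\<close> hold exactly the sums
  over \<open>[l, r)\<close>, so this has to be carried along as an invariant.  Backtracking terminates because
  every \<open>B\<^sub>l\<close> with \<open>l < r\<close> is finite, whence the candidate \<open>l = r - 1\<close> already improves on
  \<open>B\<^sub>r = \<infinity>\<close> and the pointer of \<open>r\<close> ends up in \<open>[1, r)\<close>; it visits at most \<open>n\<close> nodes.  For the final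
  recomputation of the estimators the crude bound of at most \<open>n\<close> intervals of at most \<open>n\<close> points
  each suffices.  All cells ever written lie in one explicit set of \<open>O(n + p\<^sup>2)\<close> addresses.
\<close>

section \<open>Weakest preconditions with time and space\<close>

text \<open>Existence of a terminating run makes this total correctness. Space is tracked as
  containment in a fixed address set \<open>A\<close> rather than as a number: cells reused by
  several commands are then counted once, and sequencing involves no cardinalities. The output is
  left free.\<close>

definition wp :: "solver \<Rightarrow> addr set \<Rightarrow> com \<Rightarrow> (nat \<Rightarrow> heap \<Rightarrow> bool) \<Rightarrow> heap \<Rightarrow> bool" where
  "wp S A c Q h \<longleftrightarrow> (\<exists>h' out t W. exec S c h h' out t W \<and> W \<subseteq> A \<and> Q t h')"

lemma wp_mono:
  assumes "wp S A c Q h" and "\<And>t g. Q t g \<Longrightarrow> R t g"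
  shows "wp S A c R h"
  using assms unfolding wp_def by blast

lemma wp_SKIP [simp]: "wp S A SKIP Q h \<longleftrightarrow> Q 0 h"
  unfolding wp_def by (blast elim: SkipE intro: exec.Skip)

lemma wp_Assign [simp]:
  "wp S A (Assign x es e) Q h \<longleftrightarrow>
     Loc x (map (\<lambda>i. index (eval i h)) es) \<in> A \<and> tmps ((\<Sum>i\<leftarrow>es. nops i) + nops e) \<subseteq> A \<and>
     Q ((\<Sum>i\<leftarrow>es. nops i) + nops e) (h(Loc x (map (\<lambda>i. index (eval i h)) es) := eval e h))"
proof -
  have "exec S (Assign x es e) h h' out t W \<longleftrightarrow>
      h' = h(Loc x (map (\<lambda>i. index (eval i h)) es) := eval e h) \<and> out = [] \<and>
      t = (\<Sum>i\<leftarrow>es. nops i) + nops e \<and>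
      W = insert (Loc x (map (\<lambda>i. index (eval i h)) es)) (tmps ((\<Sum>i\<leftarrow>es. nops i) + nops e))"
    for h' out t W
    by (auto elim!: AssignE intro!: exec.Assign)
  then show ?thesis
    unfolding wp_def by auto
qed

lemma wp_Seq [simp]:
  "wp S A (c1;; c2) Q h \<longleftrightarrow> wp S A c1 (\<lambda>t1. wp S A c2 (\<lambda>t2. Q (t1 + t2))) h"
proof
  assume "wp S A (c1;; c2) Q h"
  then show "wp S A c1 (\<lambda>t1. wp S A c2 (\<lambda>t2. Q (t1 + t2))) h"
    unfolding wp_def by (elim exE conjE SeqE) blast
next
  assume "wp S A c1 (\<lambda>t1. wp S A c2 (\<lambda>t2. Q (t1 + t2))) h"
  then show "wp S A (c1;; c2) Q h"
    unfolding wp_def by (metis Un_least exec.Seq)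
qed

lemma wp_If [simp]:
  "wp S A (IF b THEN c1 ELSE c2) Q h \<longleftrightarrow>
     tmps (cond_ops b) \<subseteq> A \<and> wp S A (if holds b h then c1 else c2) (\<lambda>t. Q (cond_ops b + t)) h"
proof
  assume "wp S A (IF b THEN c1 ELSE c2) Q h"
  then show "tmps (cond_ops b) \<subseteq> A \<and>
      wp S A (if holds b h then c1 else c2) (\<lambda>t. Q (cond_ops b + t)) h"
    unfolding wp_def by (elim exE conjE IfE) auto
next
  assume "tmps (cond_ops b) \<subseteq> A \<and>
      wp S A (if holds b h then c1 else c2) (\<lambda>t. Q (cond_ops b + t)) h"
  then show "wp S A (IF b THEN c1 ELSE c2) Q h"
    unfolding wp_def by (metis Un_least exec.IfFalse exec.IfTrue)
qed

lemma wp_PRINT [simp]: "wp S A (PRINT e) Q h \<longleftrightarrow> tmps (nops e) \<subseteq> A \<and> Q (nops e) h"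
  unfolding wp_def by (auto elim!: PrintE intro!: exec.Print exI)

lemma wp_LASSO:
  assumes "run = S (index (eval em h)) (real_of_ereal (eval el h))
      (read_vec (index (eval ep h)) v h) (read_mat (index (eval ep h)) w h)"
    and "tmps (nops ep + nops em + nops el) \<subseteq> A"
    and "\<And>i. i < index (eval ep h) \<Longrightarrow> Loc x [i] \<in> A"
    and "Work ` {..<workspace run} \<subseteq> A"
    and "Q (nops ep + nops em + nops el + flops run) (write_vec (index (eval ep h)) x (estimate run) h)"
  shows "wp S A (LASSO ep em el v w x) Q h"
proof -
  have "exec S (LASSO ep em el v w x) h (write_vec (index (eval ep h)) x (estimate run) h) []
      (nops ep + nops em + nops el + flops run)
      (tmps (nops ep + nops em + nops el) \<union> (\<lambda>i. Loc x [i]) ` {..<index (eval ep h)} \<union>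
        Work ` {..<workspace run})"
    using refl assms(1) refl by (rule exec.Lasso)
  moreover have "tmps (nops ep + nops em + nops el) \<union> (\<lambda>i. Loc x [i]) ` {..<index (eval ep h)} \<union>
      Work ` {..<workspace run} \<subseteq> A"
    using assms(2-4) by auto
  ultimately show ?thesis
    unfolding wp_def using assms(5) by blast
qed

text \<open>\<open>J m\<close> combines invariant and variant. The variant may fall by more than one
  per round, hence the strong induction; the time bound charges \<open>m\<close> rounds and the last
  failing test. Backtracking, whose pointers may jump, needs this generality.\<close>

lemma wp_While:
  assumes step: "\<And>m g. J m g \<Longrightarrow> holds b g \<Longrightarrow> wp S A c (\<lambda>t g'. t \<le> T \<and> (\<exists>m'<m. J m' g')) g"
    and "tmps (cond_ops b) \<subseteq> A" and "J m h"
  shows "wp S A (WHILE b DO c)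
    (\<lambda>t g. t \<le> cond_ops b + m * (cond_ops b + T) \<and> \<not> holds b g \<and> (\<exists>m. J m g)) h"
  using \<open>J m h\<close>
proof (induction m arbitrary: h rule: less_induct)
  case (less m)
  show ?case
  proof (cases "holds b h")
    case True
    with step[OF less.prems] obtain h' out t W m' where 1: "exec S c h h' out t W" "W \<subseteq> A" "t \<le> T"
        and m': "m' < m" "J m' h'"
      unfolding wp_def by blast
    from less.IH[OF m'] obtain h'' out' t' W' where
      2: "exec S (WHILE b DO c) h' h'' out' t' W'" "W' \<subseteq> A"
        "t' \<le> cond_ops b + m' * (cond_ops b + T)" "\<not> holds b h''" "\<exists>m. J m h''"
      unfolding wp_def by blast
    \<comment> \<open>One of the \<open>m\<close> rounds in the budget pays for the current round;
      the remaining ones cover the recursive call.\<close>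
    have "Suc m' * (cond_ops b + T) \<le> m * (cond_ops b + T)"
      using m'(1) by (intro mult_le_mono) auto
    then have "cond_ops b + t + t' \<le> cond_ops b + m * (cond_ops b + T)"
      using 1(3) 2(3) by simp
    moreover have "exec S (WHILE b DO c) h h'' (out @ out') (cond_ops b + t + t')
        (tmps (cond_ops b) \<union> W \<union> W')"
      using True 1(1) 2(1) by (rule exec.WhileTrue)
    ultimately show ?thesis
      unfolding wp_def using assms(2) 1(2) 2 by (metis Un_least)
  next
    case False
    show ?thesis
      unfolding wp_def using exec.WhileFalse[OF False] False less.prems assms(2)
      by (metis le_add1)
  qed
qed

text \<open>The range is half-open: \<open>b\<close> denotes the last index \<open>hi - 1\<close>,
  computed in the reals, so that \<open>hi = 0\<close> is included. \<open>b\<close> is evaluated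
  afresh at every test, hence the premise on all states satisfying \<open>I\<close>. The overhead
  \<open>nops b + 2\<close> per round is the bound, the comparison and the increment.\<close>

lemma wp_For:
  fixes lo hi :: nat
  assumes a: "eval a h = ereal (real lo)" and le: "lo \<le> hi"
    and init: "I lo (h(Loc x [] := ereal (real lo)))"
    and b: "\<And>i g. lo \<le> i \<Longrightarrow> i \<le> hi \<Longrightarrow> I i g \<Longrightarrow> g (Loc x []) = ereal (real i) \<Longrightarrow>
        eval b g = ereal (real hi - 1)"
    and step: "\<And>i g. lo \<le> i \<Longrightarrow> i < hi \<Longrightarrow> I i g \<Longrightarrow> g (Loc x []) = ereal (real i) \<Longrightarrow>
        wp S A c (\<lambda>t g'. t \<le> T \<and> g' (Loc x []) = ereal (real i) \<and>
          I (Suc i) (g'(Loc x [] := ereal (real (Suc i))))) g"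
    and A: "Loc x [] \<in> A" "tmps (Suc (nops a + nops b)) \<subseteq> A"
    and post: "\<And>t g. t \<le> nops a + nops b + 1 + (hi - lo) * (T + nops b + 2) \<Longrightarrow> I hi g \<Longrightarrow> Q t g"
  shows "wp S A (FOR x = a TO b DO c) Q h"
proof -
  have tmps: "tmps k \<subseteq> A" if "k \<le> Suc (nops a + nops b)" for k
    using A(2) that unfolding tmps_def by force
  define J where "J m g \<longleftrightarrow> (\<exists>i. lo \<le> i \<and> i \<le> hi \<and> m = hi - i \<and> g (Loc x []) = ereal (real i) \<and> I i g)"
    for m g
  have "wp S A (WHILE Leq (Var x) b DO (c;; x ::= Var x \<^bold>+ Const 1))
    (\<lambda>t g. t \<le> cond_ops (Leq (Var x) b) + (hi - lo) * (cond_ops (Leq (Var x) b) + (T + 1)) \<and>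
      \<not> holds (Leq (Var x) b) g \<and> (\<exists>m. J m g)) (h(Loc x [] := ereal (real lo)))"
  proof (rule wp_While)
    fix m g
    assume "J m g" and h: "holds (Leq (Var x) b) g"
    then obtain i where i: "lo \<le> i" "i \<le> hi" "m = hi - i" "g (Loc x []) = ereal (real i)" "I i g"
      unfolding J_def by blast
    with h b[OF i(1,2,5,4)] have "i < hi" by simp
    from step[OF i(1) this i(5,4)]
    show "wp S A (c;; x ::= Var x \<^bold>+ Const 1) (\<lambda>t g'. t \<le> T + 1 \<and> (\<exists>m'<m. J m' g')) g"
      unfolding wp_Seq
    proof (rule wp_mono)
      fix t g'
      assume *: "t \<le> T \<and> g' (Loc x []) = ereal (real i) \<and>
          I (Suc i) (g'(Loc x [] := ereal (real (Suc i))))"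
      have "J (hi - Suc i) (g'(Loc x [] := ereal (real (Suc i))))"
        unfolding J_def using * i \<open>i < hi\<close> by (intro exI[of _ "Suc i"]) auto
      moreover have "hi - Suc i < m" using i \<open>i < hi\<close> by simp
      ultimately show "wp S A (x ::= Var x \<^bold>+ Const 1)
          (\<lambda>t2 g'. t + t2 \<le> T + 1 \<and> (\<exists>m'<m. J m' g')) g'"
        using * A(1) tmps[of 1] by (auto simp: one_ereal_def add.commute)
    qed
  next
    show "tmps (cond_ops (Leq (Var x) b)) \<subseteq> A" using tmps by simp
    show "J (hi - lo) (h(Loc x [] := ereal (real lo)))"
      unfolding J_def using le init by (intro exI[of _ lo]) auto
  qed
  then have "wp S A (WHILE Leq (Var x) b DO (c;; x ::= Var x \<^bold>+ Const 1))
      (\<lambda>t. Q (nops a + t)) (h(Loc x [] := ereal (real lo)))"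
  proof (rule wp_mono)
    fix t g
    assume *: "t \<le> cond_ops (Leq (Var x) b) + (hi - lo) * (cond_ops (Leq (Var x) b) + (T + 1)) \<and>
        \<not> holds (Leq (Var x) b) g \<and> (\<exists>m. J m g)"
    then obtain i where i: "lo \<le> i" "i \<le> hi" "g (Loc x []) = ereal (real i)" "I i g"
      unfolding J_def by blast
    with * b[OF i(1,2,4,3)] have "i = hi" by auto
    with i * show "Q (nops a + t) g" by (intro post) (auto simp: algebra_simps)
  qed
  then show ?thesis
    unfolding For_def using a A(1) tmps by simp
qed

text \<open>\<open>I i\<close> is the invariant once the body has been executed for the values \<open>i, \<dots>, hi - 1\<close>; this
  indexing avoids the value \<open>lo - 1\<close>.\<close>

lemma wp_ForDown:
  fixes lo hi :: nat
  assumes a: "eval a h = ereal (real hi - 1)" and le: "lo \<le> hi"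
    and init: "I hi (h(Loc x [] := ereal (real hi - 1)))"
    and b: "\<And>i g. lo \<le> i \<Longrightarrow> i \<le> hi \<Longrightarrow> I i g \<Longrightarrow> eval b g = ereal (real lo)"
    and step: "\<And>i g. lo \<le> i \<Longrightarrow> i < hi \<Longrightarrow> I (Suc i) g \<Longrightarrow> g (Loc x []) = ereal (real i) \<Longrightarrow>
        wp S A c (\<lambda>t g'. t \<le> T \<and> g' (Loc x []) = ereal (real i) \<and>
          I i (g'(Loc x [] := ereal (real i - 1)))) g"
    and A: "Loc x [] \<in> A" "tmps (Suc (nops a + nops b)) \<subseteq> A"
    and post: "\<And>t g. t \<le> nops a + nops b + 1 + (hi - lo) * (T + nops b + 2) \<Longrightarrow> I lo g \<Longrightarrow> Q t g"
  shows "wp S A (FOR x = a DOWNTO b DO c) Q h"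
proof -
  have tmps: "tmps k \<subseteq> A" if "k \<le> Suc (nops a + nops b)" for k
    using A(2) that unfolding tmps_def by force
  define J where "J m g \<longleftrightarrow> (\<exists>i. lo \<le> i \<and> i \<le> hi \<and> m = i - lo \<and> g (Loc x []) = ereal (real i - 1) \<and> I i g)"
    for m g
  have "wp S A (WHILE Leq b (Var x) DO (c;; x ::= Var x \<^bold>- Const 1))
    (\<lambda>t g. t \<le> cond_ops (Leq b (Var x)) + (hi - lo) * (cond_ops (Leq b (Var x)) + (T + 1)) \<and>
      \<not> holds (Leq b (Var x)) g \<and> (\<exists>m. J m g)) (h(Loc x [] := ereal (real hi - 1)))"
  proof (rule wp_While)
    fix m g
    assume "J m g" and h: "holds (Leq b (Var x)) g"
    then obtain i where i: "lo \<le> i" "i \<le> hi" "m = i - lo" "g (Loc x []) = ereal (real i - 1)" "I i g"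
      unfolding J_def by blast
    \<comment> \<open>In state \<open>I i\<close> the counter holds \<open>i - 1\<close>, so passing
      the test \<open>lo <= i - 1\<close> means that \<open>k = i - 1\<close> is still to be
      processed.\<close>
    with h b[OF i(1,2,5)] have "lo < i" by auto
    then obtain k where k: "i = Suc k" "lo \<le> k" by (cases i) auto
    with i have "k < hi" "I (Suc k) g" "g (Loc x []) = ereal (real k)" by auto
    from step[OF k(2) this]
    show "wp S A (c;; x ::= Var x \<^bold>- Const 1) (\<lambda>t g'. t \<le> T + 1 \<and> (\<exists>m'<m. J m' g')) g"
      unfolding wp_Seq
    proof (rule wp_mono)
      fix t g'
      assume *: "t \<le> T \<and> g' (Loc x []) = ereal (real k) \<and>
          I k (g'(Loc x [] := ereal (real k - 1)))"
      have "J (k - lo) (g'(Loc x [] := ereal (real k - 1)))"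
        unfolding J_def using * i k by (intro exI[of _ k]) auto
      moreover have "k - lo < m" using i k by simp
      ultimately show "wp S A (x ::= Var x \<^bold>- Const 1)
          (\<lambda>t2 g'. t + t2 \<le> T + 1 \<and> (\<exists>m'<m. J m' g')) g'"
        using * A(1) tmps[of 1] by (auto simp: one_ereal_def)
    qed
  next
    show "tmps (cond_ops (Leq b (Var x))) \<subseteq> A" using tmps by simp
    show "J (hi - lo) (h(Loc x [] := ereal (real hi - 1)))"
      unfolding J_def using le init by (intro exI[of _ hi]) auto
  qed
  then have "wp S A (WHILE Leq b (Var x) DO (c;; x ::= Var x \<^bold>- Const 1))
      (\<lambda>t. Q (nops a + t)) (h(Loc x [] := ereal (real hi - 1)))"
  proof (rule wp_mono)
    fix t g
    assume *: "t \<le> cond_ops (Leq b (Var x)) + (hi - lo) * (cond_ops (Leq b (Var x)) + (T + 1)) \<and>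
        \<not> holds (Leq b (Var x)) g \<and> (\<exists>m. J m g)"
    then obtain i where i: "lo \<le> i" "i \<le> hi" "g (Loc x []) = ereal (real i - 1)" "I i g"
      unfolding J_def by blast
    with * b[OF i(1,2,4)] have "i = lo" by auto
    with i * show "Q (nops a + t) g" by (intro post) (auto simp: algebra_simps)
  qed
  then show ?thesis
    unfolding ForDown_def using a A(1) tmps by simp
qed


section \<open>Storage of the algorithm\<close>

lemma index_real [simp]: "index (ereal (real k)) = k"
  by (simp add: index_def)

text \<open>Records finiteness without the value. Termination needs no more about losses and table
  entries: a finite candidate always improves on the initial infinity.\<close>

definition is_real :: "ereal \<Rightarrow> bool" where
  "is_real v \<longleftrightarrow> v \<in> range ereal"

lemma is_real_ereal [simp]: "is_real (ereal x)"
  by (simp add: is_real_def)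

lemma is_real_const [simp]: "is_real 0" "is_real 1" "is_real (numeral k)"
  by (simp_all add: is_real_def zero_ereal_def one_ereal_def numeral_eq_ereal)

lemma is_real_arith [simp]:
  "is_real a \<Longrightarrow> is_real (- a)"
  "is_real a \<Longrightarrow> is_real b \<Longrightarrow> is_real (a + b)"
  "is_real a \<Longrightarrow> is_real b \<Longrightarrow> is_real (a * b)"
  by (cases a; auto simp: is_real_def)+

text \<open>A frame condition by array name. Only \<open>Loc\<close> cells matter, since expressions
  and solver calls read no others.\<close>

definition unchanged :: "string set \<Rightarrow> heap \<Rightarrow> heap \<Rightarrow> bool" where
  "unchanged N h g \<longleftrightarrow> (\<forall>x is. x \<notin> N \<longrightarrow> g (Loc x is) = h (Loc x is))"

lemma unchanged_refl [simp]: "unchanged N h h"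
  by (simp add: unchanged_def)

lemma unchanged_update [simp]: "x \<in> N \<Longrightarrow> unchanged N h (g(Loc x is := v)) \<longleftrightarrow> unchanged N h g"
  by (auto simp: unchanged_def)

lemma unchanged_update_left [simp]: "x \<in> N \<Longrightarrow> unchanged N (h(Loc x is := v)) g \<longleftrightarrow> unchanged N h g"
  by (auto simp: unchanged_def)

lemma unchanged_trans: "unchanged N h g \<Longrightarrow> unchanged N' g g' \<Longrightarrow> N' \<subseteq> N \<Longrightarrow> unchanged N h g'"
  by (auto simp: unchanged_def)

lemma unchanged_mono: "unchanged N h g \<Longrightarrow> N \<subseteq> N' \<Longrightarrow> unchanged N' h g"
  by (auto simp: unchanged_def)

lemma unchangedD: "unchanged N h g \<Longrightarrow> x \<notin> N \<Longrightarrow> g (Loc x is) = h (Loc x is)"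
  by (auto simp: unchanged_def)

text \<open>Overwriting a cell of \<open>x\<close> can be undone by another change confined to
  \<open>x\<close>, so stability under such changes yields an equivalence, which is usable as a simp
  rule.\<close>

lemma update_iff:
  assumes "\<And>h g. P h \<Longrightarrow> unchanged {x} h g \<Longrightarrow> P g"
  shows "P (h(Loc x is := v)) \<longleftrightarrow> P h"
  using assms[of h "h(Loc x is := v)"] assms[of "h(Loc x is := v)" h] by auto

text \<open>An upper bound instead of the exact set of written cells: all indices up to
  \<open>n + 1\<close> are allotted to \<open>B\<close>, \<open>ptr\<close> and \<open>Bhat\<close>,
  and eight temporaries exceed the operation count of every expression of the program. One array
  \<open>beta\<close> suffices because each estimate overwrites the previous one.\<close>

definition cells :: "nat \<Rightarrow> nat \<Rightarrow> nat \<Rightarrow> addr set" where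
  "cells n p w =
     (\<lambda>x. Loc x []) ` {''num'', ''r'', ''l'', ''i'', ''j'', ''m'', ''b'', ''k'', ''h'', ''q'',
        ''lin'', ''quad'', ''G''} \<union>
     (\<lambda>(x, i). Loc x [i]) ` ({''V'', ''beta''} \<times> {..<p} \<union> {''B'', ''ptr'', ''Bhat''} \<times> {..n + 1}) \<union>
     (\<lambda>(i, j). Loc ''M'' [i, j]) ` ({..<p} \<times> {..<p}) \<union>
     tmps 8 \<union> Work ` {..<w}"

lemma scalar_in_cells [simp]:
  "Loc x [] \<in> cells n p w \<longleftrightarrow>
     x \<in> {''num'', ''r'', ''l'', ''i'', ''j'', ''m'', ''b'', ''k'', ''h'', ''q'', ''lin'', ''quad'', ''G''}"
  by (auto simp: cells_def tmps_def)

lemma array_in_cells [simp]: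
  "Loc x [i] \<in> cells n p w \<longleftrightarrow>
     x \<in> {''V'', ''beta''} \<and> i < p \<or> x \<in> {''B'', ''ptr'', ''Bhat''} \<and> i \<le> n + 1"
  by (auto simp: cells_def tmps_def)

lemma matrix_in_cells [simp]: "Loc x [i, j] \<in> cells n p w \<longleftrightarrow> x = ''M'' \<and> i < p \<and> j < p"
  by (auto simp: cells_def tmps_def)

lemma tmps_subset_cells [simp]: "k \<le> 8 \<Longrightarrow> tmps k \<subseteq> cells n p w"
  unfolding cells_def tmps_def by force

lemma Work_subset_cells: "k \<le> w \<Longrightarrow> Work ` {..<k} \<subseteq> cells n p w"
  unfolding cells_def by force

lemma finite_cells: "finite (cells n p w)"
  by (simp add: cells_def tmps_def)

text \<open>The constant 27 consists of 13 scalars, 8 temporaries and the 6 entries by which three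
  arrays of length \<open>n + 2\<close> exceed \<open>3 * n\<close>.\<close>

lemma card_cells: "card (cells n p w) \<le> 27 + 2 * p + 3 * n + p * p + w"
proof -
  have "card ((\<lambda>x. Loc x []) ` {''num'', ''r'', ''l'', ''i'', ''j'', ''m'', ''b'', ''k'', ''h'', ''q'',
        ''lin'', ''quad'', ''G''}) \<le> 13"
    by (rule order.trans[OF card_image_le]) auto
  moreover have "card ((\<lambda>(x, i). Loc x [i]) `
      ({''V'', ''beta''} \<times> {..<p} \<union> {''B'', ''ptr'', ''Bhat''} \<times> {..n + 1})) \<le> 2 * p + 3 * (n + 2)"
    by (rule order.trans[OF card_image_le], simp, rule order.trans[OF card_Un_le])
      (simp add: card_cartesian_product)
  moreover have "card ((\<lambda>(i, j). Loc ''M'' [i, j]) ` ({..<p} \<times> {..<p})) \<le> p * p"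
    by (rule order.trans[OF card_image_le]) (simp_all add: card_cartesian_product)
  moreover have "card (tmps 8) \<le> 8"
    unfolding tmps_def by (rule order.trans[OF card_image_le]) auto
  moreover have "card (Work ` {..<w}) \<le> w"
    by (rule order.trans[OF card_image_le]) auto
  moreover have Un: "card (B \<union> C) \<le> b + c" if "card B \<le> b" "card C \<le> c" for B C :: "addr set" and b c
    using card_Un_le[of B C] that by linarith
  ultimately have "card (cells n p w) \<le> 13 + (2 * p + 3 * (n + 2)) + p * p + 8 + w"
    unfolding cells_def by (intro Un)
  then show ?thesis by simp
qed

text \<open>The fixed overhead \<open>k\<close> of a round is absorbed into the variable cost
  because \<open>1 <= E\<close>. This keeps all constants explicit throughout the loop
  proofs.\<close>

lemma loop_bound:
  fixes m n c k E :: nat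
  assumes "m \<le> n" "1 \<le> E"
  shows "m * (c * E + k) \<le> (c + k) * (n * E)"
proof -
  have "k * 1 \<le> k * E"
    using assms(2) by (rule mult_le_mono2)
  then have "m * (c * E + k) \<le> n * (c * E + k * E)"
    using assms(1) by (intro mult_le_mono) simp_all
  then show ?thesis
    by (simp only: distrib_left distrib_right ac_simps)
qed

section \<open>Elementary steps on fixed data: sums, solver call and loss\<close>

locale dpdu =
  fixes n p K :: nat and y :: "nat \<Rightarrow> real" and X :: "nat \<Rightarrow> real vec" and lam zeta :: real
    and S :: solver and Lasso :: "nat \<Rightarrow> nat"
  assumes n_pos: "1 \<le> n" and p_pos: "1 \<le> p"
    and X_carrier: "\<forall>t\<in>{1..n}. X t \<in> carrier_vec p"
    and lam_pos: "0 < lam"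
    and procedure: "lasso_procedure S Lasso K"
begin

abbreviation run :: "com \<Rightarrow> (nat \<Rightarrow> heap \<Rightarrow> bool) \<Rightarrow> heap \<Rightarrow> bool" where
  "run \<equiv> wp S (cells n p (K * p\<^sup>2))"

abbreviation input :: "heap \<Rightarrow> bool" where
  "input \<equiv> input_heap n p y X lam zeta"

lemma inputD:
  assumes "input h"
  shows "h (Loc ''n'' []) = ereal (real n)" "h (Loc ''p'' []) = ereal (real p)"
    "h (Loc ''lambda'' []) = ereal lam" "h (Loc ''zeta'' []) = ereal zeta"
    "t \<in> {1..n} \<Longrightarrow> h (Loc ''y'' [t]) = ereal (y t)"
    "t \<in> {1..n} \<Longrightarrow> i < p \<Longrightarrow> h (Loc ''X'' [t, i]) = ereal (X t $ i)"
  using assms by (auto simp: input_heap_def)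

lemma input_unchanged:
  "input h \<Longrightarrow> unchanged N h g \<Longrightarrow> N \<inter> {''n'', ''p'', ''lambda'', ''zeta'', ''y'', ''X''} = {} \<Longrightarrow> input g"
  by (auto simp: input_heap_def unchanged_def)

lemma input_update [simp]:
  assumes "x \<notin> {''n'', ''p'', ''lambda'', ''zeta'', ''y'', ''X''}"
  shows "input (h(Loc x is := v)) \<longleftrightarrow> input h"
  by (rule update_iff, rule input_unchanged, assumption+) (use assms in blast)

text \<open>The counterpart of \<open>loop_bound\<close> for two nested loops over coordinates:
  \<open>1\<close> and \<open>p\<close> are at most \<open>p * p\<close>.\<close>

lemma quadratic_bound: "a + p * (b + c * p) \<le> (a + b + c) * (p * p)"
proof -
  have "1 \<le> p * p" and "p \<le> p * p"
    using p_pos by simp_all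
  then have "a * 1 + (b * p + c * (p * p)) \<le> a * (p * p) + (b * (p * p) + c * (p * p))"
    by (intro add_mono mult_le_mono2) simp_all
  then show ?thesis
    by (simp only: mult_1_right distrib_left distrib_right ac_simps)
qed

text \<open>Serves both resetting and updating. Each entry is written once and is still old when its
  expression is evaluated, so \<open>e1\<close> and \<open>e2\<close> may refer to its value in
  \<open>h\<close>; everything outside \<open>V\<close>, \<open>M\<close> and the two counters is as
  in \<open>h\<close>.\<close>

lemma fill_sums:
  assumes "input h"
    and e1: "\<And>g i. i < p \<Longrightarrow> unchanged {''i'', ''j'', ''V'', ''M''} h g \<Longrightarrow>
        g (Loc ''i'' []) = ereal (real i) \<Longrightarrow> g (Loc ''V'' [i]) = h (Loc ''V'' [i]) \<Longrightarrow> eval e1 g = ereal (v i)"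
    and e2: "\<And>g i j. i < p \<Longrightarrow> j < p \<Longrightarrow> unchanged {''i'', ''j'', ''V'', ''M''} h g \<Longrightarrow>
        g (Loc ''i'' []) = ereal (real i) \<Longrightarrow> g (Loc ''j'' []) = ereal (real j) \<Longrightarrow>
        g (Loc ''M'' [i, j]) = h (Loc ''M'' [i, j]) \<Longrightarrow> eval e2 g = ereal (w i j)"
    and nops: "nops e1 \<le> 2" "nops e2 \<le> 2"
  shows "run (FOR ''i'' = Const 0 TO Var ''p'' \<^bold>- Const 1 DO
      (''V''\<^bold>[[Var ''i'']\<^bold>] ::= e1;;
       FOR ''j'' = Const 0 TO Var ''p'' \<^bold>- Const 1 DO ''M''\<^bold>[[Var ''i'', Var ''j'']\<^bold>] ::= e2))
    (\<lambda>t g. t \<le> 14 * (p * p) \<and> unchanged {''i'', ''j'', ''V'', ''M''} h g \<and>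
      (\<forall>i<p. g (Loc ''V'' [i]) = ereal (v i)) \<and>
      (\<forall>i<p. \<forall>j<p. g (Loc ''M'' [i, j]) = ereal (w i j))) h"
proof -
  have lim: "eval (Var ''p'' \<^bold>- Const 1) g = ereal (real p - 1)"
    if "unchanged {''i'', ''j'', ''V'', ''M''} h g" for g
    using unchangedD[OF that, of "''p''" "[]"] inputD(2)[OF \<open>input h\<close>] by (simp add: one_ereal_def)
  \<comment> \<open>Rows below \<open>i\<close> are new and the others old; in \<open>J i j\<close>
    also \<open>V[i]\<close> and the first \<open>j\<close> entries of row \<open>i\<close> are
    new.\<close>
  define R where "R i g \<longleftrightarrow> unchanged {''i'', ''j'', ''V'', ''M''} h g \<and>
      (\<forall>k<p. g (Loc ''V'' [k]) = (if k < i then ereal (v k) else h (Loc ''V'' [k]))) \<and>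
      (\<forall>k<p. \<forall>m<p. g (Loc ''M'' [k, m]) = (if k < i then ereal (w k m) else h (Loc ''M'' [k, m])))"
    for i g
  define J where "J i j g \<longleftrightarrow> unchanged {''i'', ''j'', ''V'', ''M''} h g \<and> g (Loc ''i'' []) = ereal (real i) \<and>
      (\<forall>k<p. g (Loc ''V'' [k]) = (if k < Suc i then ereal (v k) else h (Loc ''V'' [k]))) \<and>
      (\<forall>k<p. \<forall>m<p. g (Loc ''M'' [k, m]) =
         (if k < i \<or> k = i \<and> m < j then ereal (w k m) else h (Loc ''M'' [k, m])))"
    for i j g
  show ?thesis
  proof (rule wp_For[where lo = 0 and hi = p and I = R and T = "4 + 5 * p"])
    fix i g
    assume i: "i < p" and R: "R i g" and gi: "g (Loc ''i'' []) = ereal (real i)"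
    define g1 where "g1 = g(Loc ''V'' [i] := ereal (v i))"
    have inner: "run (FOR ''j'' = Const 0 TO Var ''p'' \<^bold>- Const 1 DO ''M''\<^bold>[[Var ''i'', Var ''j'']\<^bold>] ::= e2)
      (\<lambda>t g'. t \<le> 2 + 5 * p \<and> J i p g') g1"
    proof (rule wp_For[where lo = 0 and hi = p and I = "J i" and T = 2])
      show "J i 0 (g1(Loc ''j'' [] := ereal (real 0)))"
        using R gi by (auto simp: R_def J_def g1_def)
    next
      fix j g'
      assume "j < p" "J i j g'" "g' (Loc ''j'' []) = ereal (real j)"
      moreover from this have "eval e2 g' = ereal (w i j)"
        using i by (intro e2) (auto simp: J_def)
      ultimately show "run (''M''\<^bold>[[Var ''i'', Var ''j'']\<^bold>] ::= e2)
        (\<lambda>t g'. t \<le> 2 \<and> g' (Loc ''j'' []) = ereal (real j) \<and>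
          J i (Suc j) (g'(Loc ''j'' [] := ereal (real (Suc j))))) g'"
        using i nops by (auto simp: J_def less_Suc_eq)
    qed (use lim in \<open>auto simp: J_def zero_ereal_def\<close>)
    have "eval e1 g = ereal (v i)"
      using i R gi by (intro e1) (auto simp: R_def)
    moreover have "run (FOR ''j'' = Const 0 TO Var ''p'' \<^bold>- Const 1 DO ''M''\<^bold>[[Var ''i'', Var ''j'']\<^bold>] ::= e2)
      (\<lambda>t g'. nops e1 + t \<le> 4 + 5 * p \<and> g' (Loc ''i'' []) = ereal (real i) \<and>
          R (Suc i) (g'(Loc ''i'' [] := ereal (real (Suc i))))) g1"
      by (rule wp_mono[OF inner]) (use nops in \<open>auto simp: J_def R_def less_Suc_eq\<close>)
    ultimately show "run (''V''\<^bold>[[Var ''i'']\<^bold>] ::= e1;;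
       FOR ''j'' = Const 0 TO Var ''p'' \<^bold>- Const 1 DO ''M''\<^bold>[[Var ''i'', Var ''j'']\<^bold>] ::= e2)
      (\<lambda>t g'. t \<le> 4 + 5 * p \<and> g' (Loc ''i'' []) = ereal (real i) \<and>
          R (Suc i) (g'(Loc ''i'' [] := ereal (real (Suc i))))) g"
      using i gi nops by (simp add: g1_def)
  next
    fix t g
    assume "t \<le> nops (Const 0) + nops (Var ''p'' \<^bold>- Const 1) + 1 +
        (p - 0) * (4 + 5 * p + nops (Var ''p'' \<^bold>- Const 1) + 2)" and "R p g"
    \<comment> \<open>The outer loop costs 2 operations for its last test and
      \<open>7 + 5 * p\<close> per row, of which 3 are loop overhead; hence
      \<open>14 = 2 + 7 + 5\<close>.\<close>
    then show "t \<le> 14 * (p * p) \<and> unchanged {''i'', ''j'', ''V'', ''M''} h g \<and>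
      (\<forall>i<p. g (Loc ''V'' [i]) = ereal (v i)) \<and>
      (\<forall>i<p. \<forall>j<p. g (Loc ''M'' [i, j]) = ereal (w i j))"
      using quadratic_bound[of 2 7 5] by (auto simp: R_def)
  qed (use lim in \<open>auto simp: R_def zero_ereal_def\<close>)
qed

definition stores_sums :: "nat set \<Rightarrow> heap \<Rightarrow> bool" where
  "stores_sums I h \<longleftrightarrow> (\<forall>i<p. h (Loc ''V'' [i]) = ereal (\<Sum>t\<in>I. y t * X t $ i)) \<and>
     (\<forall>i<p. \<forall>j<p. h (Loc ''M'' [i, j]) = ereal (\<Sum>t\<in>I. X t $ i * X t $ j))"

lemma stores_sums_unchanged: "stores_sums I h \<Longrightarrow> unchanged N h g \<Longrightarrow> ''V'' \<notin> N \<Longrightarrow> ''M'' \<notin> N \<Longrightarrow> stores_sums I g"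
  by (simp add: stores_sums_def unchanged_def)

lemma stores_sums_update [simp]:
  "x \<noteq> ''V'' \<Longrightarrow> x \<noteq> ''M'' \<Longrightarrow> stores_sums I (h(Loc x is := v)) \<longleftrightarrow> stores_sums I h"
  by (simp add: stores_sums_def)

lemma run_reset_sums:
  assumes "input h"
  shows "run reset_sums
    (\<lambda>t g. t \<le> 14 * (p * p) \<and> unchanged {''i'', ''j'', ''V'', ''M''} h g \<and> stores_sums {} g) h"
  unfolding reset_sums_def stores_sums_def sum.empty
  by (rule fill_sums[OF assms]) simp_all

text \<open>Moving the left end from \<open>Suc l\<close> to \<open>l\<close> adds one summand to
  every entry, so the sums are kept up to date at a cost of order \<open>p * p\<close>, whatever the
  length of the interval.\<close>

lemma run_update_sums:
  assumes "input h" and l: "1 \<le> l" "l < r" "r \<le> n + 1"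
    and "h (Loc ''l'' []) = ereal (real l)" and "stores_sums {Suc l..<r} h"
  shows "run update_sums
    (\<lambda>t g. t \<le> 14 * (p * p) \<and> unchanged {''i'', ''j'', ''V'', ''M''} h g \<and> stores_sums {l..<r} g) h"
proof -
  have split: "sum f {l..<r} = sum f {Suc l..<r} + f l" for f :: "nat \<Rightarrow> real"
    using l by (simp add: sum.atLeast_Suc_lessThan)
  have l': "l \<in> {1..n}"
    using l by auto
  note rd = inputD(5,6)[OF assms(1) l'] assms(5) assms(6)[unfolded stores_sums_def]
  show ?thesis
    unfolding update_sums_def stores_sums_def split
  proof (rule fill_sums[OF assms(1)])
    fix g i
    assume "i < p" "unchanged {''i'', ''j'', ''V'', ''M''} h g" "g (Loc ''i'' []) = ereal (real i)"
      "g (Loc ''V'' [i]) = h (Loc ''V'' [i])"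
    then show "eval (Cell ''V'' [Var ''i''] \<^bold>+ Cell ''y'' [Var ''l''] \<^bold>* Cell ''X'' [Var ''l'', Var ''i'']) g
        = ereal ((\<Sum>t = Suc l..<r. y t * X t $ i) + y l * X l $ i)"
      using rd by (simp add: unchanged_def)
  next
    fix g i j
    assume "i < p" "j < p" "unchanged {''i'', ''j'', ''V'', ''M''} h g" "g (Loc ''i'' []) = ereal (real i)"
      "g (Loc ''j'' []) = ereal (real j)" "g (Loc ''M'' [i, j]) = h (Loc ''M'' [i, j])"
    then show "eval (Cell ''M'' [Var ''i'', Var ''j'']
            \<^bold>+ Cell ''X'' [Var ''l'', Var ''i''] \<^bold>* Cell ''X'' [Var ''l'', Var ''j'']) g
        = ereal ((\<Sum>t = Suc l..<r. X t $ i * X t $ j) + X l $ i * X l $ j)"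
      using rd by (simp add: unchanged_def)
  qed simp_all
qed

text \<open>Applies to every nonempty interval, since the output phase also fits those shorter than
  \<open>zeta\<close>. Finiteness of \<open>beta\<close> is recorded for the sake of the
  loss.\<close>

lemma run_lasso_step:
  assumes "input h" and lr: "1 \<le> l" "l < r" "r \<le> n + 1"
    and m: "h (Loc ''m'' []) = ereal (real (r - l))" and sums: "stores_sums {l..<r} h"
  shows "run lasso_step
    (\<lambda>t g. t \<le> Lasso p \<and> unchanged {''beta''} h g \<and> (\<forall>i<p. is_real (g (Loc ''beta'' [i])))) h"
proof -
  define R where "R = S (r - l) lam (cross_sum p y X {l..<r}) (gram_sum p X {l..<r})"
  have "\<forall>t\<in>{l..<r}. X t \<in> carrier_vec p"
    using X_carrier lr by auto
  with procedure p_pos lam_pos lr(2) have R: "flops R \<le> Lasso p" "workspace R \<le> K * p\<^sup>2"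
    unfolding lasso_procedure_def Let_def R_def by blast+
  \<comment> \<open>Reading the arrays back gives exactly the two sums, so the call is of the form
    covered by \<open>lasso_procedure\<close>.\<close>
  have "read_vec p ''V'' h = cross_sum p y X {l..<r}"
    using sums by (intro eq_vecI) (auto simp: read_vec_def cross_sum_def stores_sums_def)
  moreover have "read_mat p ''M'' h = gram_sum p X {l..<r}"
    using sums by (intro eq_matI) (auto simp: read_mat_def gram_sum_def stores_sums_def)
  ultimately have run: "R = S (index (eval (Var ''m'') h)) (real_of_ereal (eval (Var ''lambda'') h))
      (read_vec (index (eval (Var ''p'') h)) ''V'' h) (read_mat (index (eval (Var ''p'') h)) ''M'' h)"
    using inputD(2,3)[OF assms(1)] m by (simp add: R_def)
  \<comment> \<open>The estimate is stored through \<open>ereal\<close>, so the entries are finite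
    for any returned vector.\<close>
  have stored: "unchanged {''beta''} h (write_vec p ''beta'' v h) \<and>
      (i < p \<longrightarrow> is_real (write_vec p ''beta'' v h (Loc ''beta'' [i])))" for v i
    by (auto simp: unchanged_def write_vec_def)
  show ?thesis
    unfolding lasso_step_def
    by (rule wp_LASSO[where run = R], rule run)
      (use R p_pos Work_subset_cells[OF R(2)] inputD(2)[OF assms(1)] stored in \<open>auto simp: Suc_le_eq\<close>)
qed

text \<open>Finite inputs keep the accumulators \<open>lin\<close> and \<open>quad\<close> finite,
  hence also \<open>G\<close>. The nested loops account for \<open>15 = 2 + 7 + 6\<close>, and two
  more operations compute \<open>G\<close>.\<close>

lemma run_loss_step:
  assumes "input h" and "stores_sums I h" and beta: "\<forall>i<p. is_real (h (Loc ''beta'' [i]))"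
  shows "run loss_step
    (\<lambda>t g. t \<le> 18 * (p * p) \<and> unchanged {''lin'', ''quad'', ''i'', ''j'', ''G''} h g \<and>
      is_real (g (Loc ''G'' []))) h"
proof -
  let ?N = "{''lin'', ''quad'', ''i'', ''j'', ''G''}"
  define J where "J g \<longleftrightarrow> unchanged ?N h g \<and> is_real (g (Loc ''lin'' [])) \<and> is_real (g (Loc ''quad'' []))"
    for g
  have lim: "eval (Var ''p'' \<^bold>- Const 1) g = ereal (real p - 1)" if "J g" for g
    using that inputD(2)[OF \<open>input h\<close>] by (auto simp: J_def one_ereal_def unchangedD)
  have rd: "is_real (g (Loc ''beta'' [i]))" "is_real (g (Loc ''V'' [i]))" "is_real (g (Loc ''M'' [i, j]))"
    if "J g" "i < p" "j < p" for g i j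
    using that assms(2) beta by (auto simp: J_def unchangedD stores_sums_def)
  have J_upd: "J (g(Loc x [] := v)) \<longleftrightarrow> J g" if "x \<in> {''i'', ''j'', ''G''}" for g x v
    using that by (auto simp: J_def)
  have inner: "run (FOR ''j'' = Const 0 TO Var ''p'' \<^bold>- Const 1 DO
         ''quad'' ::= Var ''quad''
            \<^bold>+ Cell ''beta'' [Var ''i''] \<^bold>* Cell ''M'' [Var ''i'', Var ''j''] \<^bold>* Cell ''beta'' [Var ''j''])
      (\<lambda>t g'. t \<le> 2 + 6 * p \<and> J g' \<and> g' (Loc ''i'' []) = ereal (real i)) g"
    if "J g" "g (Loc ''i'' []) = ereal (real i)" "i < p" for g i
    by (rule wp_For[where lo = 0 and hi = p and T = 3 and
          I = "\<lambda>_ g'. J g' \<and> g' (Loc ''i'' []) = ereal (real i)"])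
      (use lim that rd in \<open>auto simp: J_upd zero_ereal_def, auto simp: J_def\<close>)
  have outer: "run (FOR ''i'' = Const 0 TO Var ''p'' \<^bold>- Const 1 DO
      (''lin'' ::= Var ''lin'' \<^bold>+ Cell ''V'' [Var ''i''] \<^bold>* Cell ''beta'' [Var ''i''];;
       FOR ''j'' = Const 0 TO Var ''p'' \<^bold>- Const 1 DO
         ''quad'' ::= Var ''quad''
            \<^bold>+ Cell ''beta'' [Var ''i''] \<^bold>* Cell ''M'' [Var ''i'', Var ''j''] \<^bold>* Cell ''beta'' [Var ''j'']))
      (\<lambda>t g. t \<le> 15 * (p * p) \<and> J g) g" if "J g" for g
  proof (rule wp_For[where lo = 0 and hi = p and T = "4 + 6 * p" and I = "\<lambda>_. J"])
    fix i g
    assume i: "i < p" and J: "J g" and gi: "g (Loc ''i'' []) = ereal (real i)"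
    let ?g = "g(Loc ''lin'' [] := g (Loc ''lin'' []) + g (Loc ''V'' [i]) * g (Loc ''beta'' [i]))"
    have "J ?g" using J rd[OF J i i] by (simp add: J_def)
    from inner[OF this, of i] gi i
    show "run (''lin'' ::= Var ''lin'' \<^bold>+ Cell ''V'' [Var ''i''] \<^bold>* Cell ''beta'' [Var ''i''];;
       FOR ''j'' = Const 0 TO Var ''p'' \<^bold>- Const 1 DO
         ''quad'' ::= Var ''quad''
            \<^bold>+ Cell ''beta'' [Var ''i''] \<^bold>* Cell ''M'' [Var ''i'', Var ''j''] \<^bold>* Cell ''beta'' [Var ''j''])
      (\<lambda>t g'. t \<le> 4 + 6 * p \<and> g' (Loc ''i'' []) = ereal (real i) \<and>
          J (g'(Loc ''i'' [] := ereal (real (Suc i))))) g"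
      by (auto simp: J_upd elim!: wp_mono)
  next
    fix t g
    assume "t \<le> nops (Const 0) + nops (Var ''p'' \<^bold>- Const 1) + 1 +
        (p - 0) * (4 + 6 * p + nops (Var ''p'' \<^bold>- Const 1) + 2)" and "J g"
    then show "t \<le> 15 * (p * p) \<and> J g"
      using quadratic_bound[of 2 7 6] by auto
  qed (use lim that in \<open>auto simp: J_upd zero_ereal_def\<close>)
  have "J (h(Loc ''lin'' [] := 0, Loc ''quad'' [] := 0))"
    by (simp add: J_def)
  moreover have T: "Suc (Suc t) \<le> 18 * (p * p)" if "t \<le> 15 * (p * p)" for t
    using that mult_le_mono[OF p_pos p_pos] by linarith
  ultimately show ?thesis
    unfolding loss_step_def by simp (rule wp_mono[OF outer], simp_all add: J_def)
qed


section \<open>Dynamic programme\<close>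

text \<open>\<open>r\<close> is the row in progress and \<open>d\<close> tells whether it has
  received a candidate: rows below \<open>r\<close> are complete, later ones still infinite.
  \<open>r = n + 2\<close> describes the finished table, hence the guard \<open>r <= n + 1\<close>.
  \<open>num = 0\<close> is carried along for backtracking.\<close>

definition table :: "nat \<Rightarrow> bool \<Rightarrow> heap \<Rightarrow> bool" where
  "table r d h \<longleftrightarrow> input h \<and> h (Loc ''num'' []) = 0 \<and>
     (\<forall>k\<in>{1..<r}. is_real (h (Loc ''B'' [k]))) \<and>
     (\<forall>k\<in>{2..<r}. \<exists>l\<in>{1..<k}. h (Loc ''ptr'' [k]) = ereal (real l)) \<and>
     (\<forall>k\<in>{Suc r..n + 1}. h (Loc ''B'' [k]) = \<infinity>) \<and>
     (if d then is_real (h (Loc ''B'' [r])) \<and> (\<exists>l\<in>{1..<r}. h (Loc ''ptr'' [r]) = ereal (real l))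
      else r \<le> n + 1 \<longrightarrow> h (Loc ''B'' [r]) = \<infinity>)"

lemma table_unchanged:
  assumes "table r d h" and "unchanged N h g"
    and "N \<inter> {''n'', ''p'', ''lambda'', ''zeta'', ''y'', ''X'', ''num'', ''B'', ''ptr''} = {}"
  shows "table r d g"
proof -
  have "input g"
    using assms(1,3) by (intro input_unchanged[OF _ assms(2)]) (simp_all add: table_def)
  moreover have "''num'' \<notin> N" "''B'' \<notin> N" "''ptr'' \<notin> N"
    using assms(3) by simp_all
  ultimately show ?thesis
    using assms(1) by (simp add: table_def unchangedD[OF assms(2)] split: if_splits)
qed

lemma table_update [simp]:
  assumes "x \<notin> {''n'', ''p'', ''lambda'', ''zeta'', ''y'', ''X'', ''num'', ''B'', ''ptr''}"
  shows "table r d (h(Loc x is := v)) \<longleftrightarrow> table r d h"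
  by (rule update_iff, rule table_unchanged, assumption+) (use assms in blast)

lemma table_Suc: "2 \<le> r \<Longrightarrow> table r True h \<Longrightarrow> table (Suc r) False h"
  unfolding table_def by (simp add: atLeastLessThanSuc)

lemma run_dp_init:
  assumes "input h"
  shows "run dp_init (\<lambda>t g. t \<le> 9 * n \<and> table 2 False g) h"
proof -
  define J where "J i g \<longleftrightarrow> input g \<and> g (Loc ''num'' []) = 0 \<and> (\<forall>k\<in>{1..<i}. g (Loc ''B'' [k]) = \<infinity>)"
    for i :: nat and g
  \<comment> \<open>There are \<open>n + 1\<close> rounds of 3 operations, and the last test costs
    2.\<close>
  have "run (FOR ''r'' = Const 1 TO Var ''n'' \<^bold>+ Const 1 DO
      (''ptr''\<^bold>[[Var ''r'']\<^bold>] ::= Const (-1);; ''B''\<^bold>[[Var ''r'']\<^bold>] ::= Const \<infinity>))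
    (\<lambda>t g. t \<le> 5 + 3 * n \<and> J (n + 2) g) (h(Loc ''num'' [] := 0))"
  proof (rule wp_For[where lo = 1 and hi = "n + 2" and T = 0 and I = J])
    fix i g
    assume "1 \<le> i" "i < n + 2" "J i g" "g (Loc ''r'' []) = ereal (real i)"
    then show "run (''ptr''\<^bold>[[Var ''r'']\<^bold>] ::= Const (-1);; ''B''\<^bold>[[Var ''r'']\<^bold>] ::= Const \<infinity>)
       (\<lambda>t g. t \<le> 0 \<and> g (Loc ''r'' []) = ereal (real i) \<and>
          J (Suc i) (g(Loc ''r'' [] := ereal (real (Suc i))))) g"
      by (simp add: J_def atLeastLessThanSuc)
  qed (use assms in \<open>simp_all add: J_def inputD(1) one_ereal_def\<close>)
  then have "run (FOR ''r'' = Const 1 TO Var ''n'' \<^bold>+ Const 1 DO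
      (''ptr''\<^bold>[[Var ''r'']\<^bold>] ::= Const (-1);; ''B''\<^bold>[[Var ''r'']\<^bold>] ::= Const \<infinity>))
    (\<lambda>t. run (''B''\<^bold>[[Const 1]\<^bold>] ::= Const 0 \<^bold>- Var ''zeta'')
      (\<lambda>t' g. t + t' \<le> 9 * n \<and> table 2 False g)) (h(Loc ''num'' [] := 0))"
  proof (rule wp_mono)
    fix t g
    assume *: "t \<le> 5 + 3 * n \<and> J (n + 2) g"
    \<comment> \<open>Row 1 holds the finite value \<open>-zeta\<close> and counts as complete; row
      2 is next and still infinite.\<close>
    have "table 2 False (g(Loc ''B'' [Suc 0] := 0 - g (Loc ''zeta'' [])))"
      using * n_pos by (simp add: table_def J_def inputD(4) zero_ereal_def)
    then show "run (''B''\<^bold>[[Const 1]\<^bold>] ::= Const 0 \<^bold>- Var ''zeta'')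
        (\<lambda>t' g. t + t' \<le> 9 * n \<and> table 2 False g) g"
      using * n_pos index_real[of 1] by (simp add: one_ereal_def)
  qed
  then show ?thesis
    unfolding dp_init_def by simp
qed

text \<open>Up to a constant factor, the cost of one round of the inner loop.\<close>

definition E :: nat where
  "E = p * p + Lasso p"

lemma E_ge: "1 \<le> E" "p * p \<le> E" "Lasso p \<le> E" "p \<le> E" "E \<le> n * E" "1 \<le> n * E"
proof -
  show 1: "1 \<le> E" "p * p \<le> E" "Lasso p \<le> E" "p \<le> E"
    using mult_le_mono[OF p_pos p_pos] mult_le_mono1[OF p_pos, of p] unfolding E_def by linarith+
  show "E \<le> n * E"
    using mult_le_mono1[OF n_pos, of E] by simp
  with 1(1) show "1 \<le> n * E" by linarith
qed

text \<open>Both branches leave a finite \<open>G\<close>; \<open>20 * E\<close> covers the test,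
  one solver call and \<open>18 * (p * p)\<close> for the loss.\<close>

lemma run_fit:
  assumes "input h" and lr: "1 \<le> l" "l < r" "r \<le> n + 1"
    and m: "h (Loc ''m'' []) = ereal (real (r - l))" and sums: "stores_sums {l..<r} h"
  shows "run (IF Leq (Var ''zeta'') (Var ''m'') THEN (lasso_step;; loss_step) ELSE ''G'' ::= Const 0)
    (\<lambda>t g. t \<le> 20 * E \<and> unchanged {''beta'', ''lin'', ''quad'', ''i'', ''j'', ''G''} h g \<and>
      is_real (g (Loc ''G'' []))) h"
proof -
  let ?N = "{''beta'', ''lin'', ''quad'', ''i'', ''j'', ''G''}"
  have "run lasso_step (\<lambda>t1. run loss_step (\<lambda>t2 g. 1 + (t1 + t2) \<le> 20 * E \<and> unchanged ?N h g \<and>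
      is_real (g (Loc ''G'' [])))) h"
  proof (rule wp_mono[OF run_lasso_step[OF assms]])
    fix t1 g1
    assume 1: "t1 \<le> Lasso p \<and> unchanged {''beta''} h g1 \<and> (\<forall>i<p. is_real (g1 (Loc ''beta'' [i])))"
    have "input g1" using input_unchanged[OF assms(1), of "{''beta''}" g1] 1 by simp
    moreover have "stores_sums {l..<r} g1" using stores_sums_unchanged[OF sums, of "{''beta''}" g1] 1 by simp
    ultimately show "run loss_step (\<lambda>t2 g. 1 + (t1 + t2) \<le> 20 * E \<and> unchanged ?N h g \<and>
      is_real (g (Loc ''G'' []))) g1"
    proof (rule wp_mono[OF run_loss_step])
      show "\<forall>i<p. is_real (g1 (Loc ''beta'' [i]))" using 1 by blast
      fix t g
      assume 2: "t \<le> 18 * (p * p) \<and> unchanged {''lin'', ''quad'', ''i'', ''j'', ''G''} g1 g \<and>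
          is_real (g (Loc ''G'' []))"
      have "1 + (t1 + t) \<le> 20 * E"
        using conjunct1[OF 1] conjunct1[OF 2] E_ge by linarith
      moreover have "unchanged ?N h g"
      proof (rule unchanged_trans)
        show "unchanged ?N h g1" using 1 by (blast intro: unchanged_mono)
        show "unchanged {''lin'', ''quad'', ''i'', ''j'', ''G''} g1 g" using 2 by blast
      qed simp
      ultimately show "1 + (t1 + t) \<le> 20 * E \<and> unchanged ?N h g \<and> is_real (g (Loc ''G'' []))"
        using 2 by blast
    qed
  qed
  then show ?thesis
    using E_ge(1) by (cases "holds (Leq (Var ''zeta'') (Var ''m'')) h") simp_all
qed

text \<open>The candidate is finite because row \<open>l < r\<close> is complete. If it improves on
  row \<open>r\<close>, that row receives it; if not, the old entry was finite already. Hence the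
  flag is \<open>True\<close> afterwards for either \<open>d\<close>.\<close>

lemma run_dp_step:
  assumes tab: "table r d h" and lr: "1 \<le> l" "l < r" "r \<le> n + 1"
    and r: "h (Loc ''r'' []) = ereal (real r)" and l: "h (Loc ''l'' []) = ereal (real l)"
    and sums: "stores_sums {Suc l..<r} h"
  shows "run (update_sums;;
         ''m'' ::= Var ''r'' \<^bold>- Var ''l'';;
         (IF Leq (Var ''zeta'') (Var ''m'')
          THEN (lasso_step;; loss_step)
          ELSE ''G'' ::= Const 0);;
         ''b'' ::= Cell ''B'' [Var ''l''] \<^bold>+ Var ''zeta'' \<^bold>+ Var ''G'';;
         (IF Less (Var ''b'') (Cell ''B'' [Var ''r''])
          THEN (''B''\<^bold>[[Var ''r'']\<^bold>] ::= Var ''b'';; ''ptr''\<^bold>[[Var ''r'']\<^bold>] ::= Var ''l'')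
          ELSE SKIP))
    (\<lambda>t g. t \<le> 40 * E \<and> table r True g \<and> g (Loc ''r'' []) = ereal (real r) \<and>
      g (Loc ''l'' []) = ereal (real l) \<and> stores_sums {l..<r} g) h"
    (is "run (_;; _;; ?fit;; ?upd) ?Q h")
proof -
  have inp: "input h" using tab by (simp add: table_def)
  \<comment> \<open>The commands are treated from last to first, with the times \<open>t1\<close>
    and \<open>t2\<close> of the earlier ones as parameters; the literal 1 is the subtraction that
    computes \<open>m\<close>.\<close>
  have upd: "run ?upd (\<lambda>t. ?Q (t1 + (1 + (t2 + t)))) g"
    if tab: "table r d g" and r: "g (Loc ''r'' []) = ereal (real r)" and l: "g (Loc ''l'' []) = ereal (real l)"
      and G: "is_real (g (Loc ''G'' []))" and sums: "stores_sums {l..<r} g"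
      and t: "t1 \<le> 14 * (p * p)" "t2 \<le> 20 * E" for t1 t2 g
  proof -
    let ?b = "g (Loc ''B'' [l]) + g (Loc ''zeta'' []) + g (Loc ''G'' [])"
    have "input g" using tab by (simp add: table_def)
    have b: "is_real ?b"
      using tab lr G inputD(4)[OF \<open>input g\<close>] by (simp add: table_def)
    \<comment> \<open>The 4 operations are 1 for \<open>m\<close>, 2 for \<open>b\<close> and 1 for
      the comparison.\<close>
    have time: "t1 + (4 + t2) \<le> 40 * E"
      using t E_ge by linarith
    show ?thesis
    proof (cases "?b < g (Loc ''B'' [r])")
      case True
      have "table r True (g(Loc ''B'' [r] := ?b, Loc ''ptr'' [r] := ereal (real l)))"
        using tab lr b unfolding table_def by simp
      then have "table r True (g(Loc ''b'' [] := ?b, Loc ''B'' [r] := ?b, Loc ''ptr'' [r] := ereal (real l)))"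
        by (subst fun_upd_twist, simp, subst fun_upd_twist, simp, simp)
      then show ?thesis
        using True r l sums time lr by simp
    next
      case False
      \<comment> \<open>A finite candidate lies below infinity, so failing to improve excludes the
        unfilled state of row \<open>r\<close>.\<close>
      have "d"
        using False b tab lr by (auto simp: table_def is_real_def split: if_splits)
      then show ?thesis
        using tab False r l sums time by simp
    qed
  qed
  have fit: "run ?fit (\<lambda>t2. run ?upd (\<lambda>t. ?Q (t1 + (1 + (t2 + t))))) g"
    if "table r d g" and r: "g (Loc ''r'' []) = ereal (real r)" and l: "g (Loc ''l'' []) = ereal (real l)"
      and "g (Loc ''m'' []) = ereal (real (r - l))"
      and "stores_sums {l..<r} g" and "t1 \<le> 14 * (p * p)" for t1 g
  proof (rule wp_mono[OF run_fit])
    show "input g" using that by (simp add: table_def)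
    fix t g2
    assume 2: "t \<le> 20 * E \<and> unchanged {''beta'', ''lin'', ''quad'', ''i'', ''j'', ''G''} g g2 \<and>
      is_real (g2 (Loc ''G'' []))"
    then have U: "unchanged {''beta'', ''lin'', ''quad'', ''i'', ''j'', ''G''} g g2" by blast
    show "run ?upd (\<lambda>ta. ?Q (t1 + (1 + (t + ta)))) g2"
      using that 2 table_unchanged[OF \<open>table r d g\<close> U] stores_sums_unchanged[OF \<open>stores_sums {l..<r} g\<close> U]
      by (intro upd) (simp_all add: unchangedD[OF U])
  qed (use that lr in simp_all)
  have "run update_sums (\<lambda>t1. run (''m'' ::= Var ''r'' \<^bold>- Var ''l'';; ?fit;; ?upd) (\<lambda>t. ?Q (t1 + t))) h"
  proof (rule wp_mono[OF run_update_sums[OF inp lr l sums]])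
    fix t1 g
    assume 1: "t1 \<le> 14 * (p * p) \<and> unchanged {''i'', ''j'', ''V'', ''M''} h g \<and> stores_sums {l..<r} g"
    then have U: "unchanged {''i'', ''j'', ''V'', ''M''} h g" by blast
    have rl: "g (Loc ''r'' []) = ereal (real r)" "g (Loc ''l'' []) = ereal (real l)"
      using r l by (simp_all add: unchangedD[OF U])
    have "run ?fit (\<lambda>t2. run ?upd (\<lambda>t. ?Q (t1 + (1 + (t2 + t))))) (g(Loc ''m'' [] := ereal (real (r - l))))"
      using 1 rl table_unchanged[OF tab U] by (intro fit) simp_all
    then show "run (''m'' ::= Var ''r'' \<^bold>- Var ''l'';; ?fit;; ?upd) (\<lambda>t. ?Q (t1 + t)) g"
      unfolding wp_Seq[of _ _ "''m'' ::= Var ''r'' \<^bold>- Var ''l''"] wp_Assign[of _ _ "''m''"]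
      using lr rl by (simp del: wp_If wp_Assign add: of_nat_diff wp_Assign[of _ _ "''m''"])
  qed
  then show ?thesis
    unfolding wp_Seq[of _ _ update_sums] .
qed

lemma run_dp_loop:
  assumes "table 2 False h"
  shows "run dp_loop (\<lambda>t g. t \<le> 70 * (n * (n * E)) \<and> table (n + 2) False g) h"
  unfolding dp_loop_def
proof (rule wp_For[where lo = 2 and hi = "n + 2" and T = "65 * (n * E)" and I = "\<lambda>r. table r False"])
  fix r g
  assume r: "2 \<le> r" "r < n + 2" and tab: "table r False g" and gr: "g (Loc ''r'' []) = ereal (real r)"
  let ?body = "update_sums;;
         ''m'' ::= Var ''r'' \<^bold>- Var ''l'';;
         (IF Leq (Var ''zeta'') (Var ''m'')
          THEN (lasso_step;; loss_step)
          ELSE ''G'' ::= Const 0);;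
         ''b'' ::= Cell ''B'' [Var ''l''] \<^bold>+ Var ''zeta'' \<^bold>+ Var ''G'';;
         (IF Less (Var ''b'') (Cell ''B'' [Var ''r''])
          THEN (''B''\<^bold>[[Var ''r'']\<^bold>] ::= Var ''b'';; ''ptr''\<^bold>[[Var ''r'']\<^bold>] ::= Var ''l'')
          ELSE SKIP)"
  let ?Q = "\<lambda>t g'. t \<le> 65 * (n * E) \<and> g' (Loc ''r'' []) = ereal (real r) \<and>
      table (Suc r) False (g'(Loc ''r'' [] := ereal (real (Suc r))))"
  have "run reset_sums (\<lambda>t1. run (FOR ''l'' = Var ''r'' \<^bold>- Const 1 DOWNTO Const 1 DO ?body) (\<lambda>t2. ?Q (t1 + t2))) g"
  proof (rule wp_mono[OF run_reset_sums])
    show "input g" using tab by (simp add: table_def)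
    fix t1 g1
    assume 1: "t1 \<le> 14 * (p * p) \<and> unchanged {''i'', ''j'', ''V'', ''M''} g g1 \<and> stores_sums {} g1"
    then have U: "unchanged {''i'', ''j'', ''V'', ''M''} g g1" by blast
    have g1: "table r False g1" "g1 (Loc ''r'' []) = ereal (real r)"
      using table_unchanged[OF tab U] gr by (simp_all add: unchangedD[OF U])
    \<comment> \<open>\<open>s\<close> is the left end reached so far; the flag
      \<open>s \<noteq> r\<close> turns true with the first round, \<open>l = r - 1\<close>.\<close>
    let ?I = "\<lambda>s g. table r (s \<noteq> r) g \<and> g (Loc ''r'' []) = ereal (real r) \<and> stores_sums {s..<r} g"
    show "run (FOR ''l'' = Var ''r'' \<^bold>- Const 1 DOWNTO Const 1 DO ?body) (\<lambda>t2. ?Q (t1 + t2)) g1"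
    proof (rule wp_ForDown[where lo = 1 and hi = r and T = "40 * E" and I = ?I])
      fix l g'
      assume l: "1 \<le> l" "l < r" and I: "?I (Suc l) g'" and gl: "g' (Loc ''l'' []) = ereal (real l)"
      have "run ?body (\<lambda>t g. t \<le> 40 * E \<and> table r True g \<and> g (Loc ''r'' []) = ereal (real r) \<and>
          g (Loc ''l'' []) = ereal (real l) \<and> stores_sums {l..<r} g) g'"
        using I l r gl by (intro run_dp_step) auto
      then show "run ?body (\<lambda>t g'. t \<le> 40 * E \<and> g' (Loc ''l'' []) = ereal (real l) \<and>
          ?I l (g'(Loc ''l'' [] := ereal (real l - 1)))) g'"
        by (rule wp_mono) (use l in simp)
    next
      fix t g'
      assume "t \<le> nops (Var ''r'' \<^bold>- Const 1) + nops (Const 1) + 1 +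
          (r - 1) * (40 * E + nops (Const 1) + 2)" and I: "?I 1 g'"
      then have "t \<le> 2 + (r - 1) * (40 * E + 2)" by simp
      also have "(r - 1) * (40 * E + 2) \<le> (40 + 2) * (n * E)"
        using r E_ge(1) by (intro loop_bound) simp_all
      finally have "t \<le> 2 + 42 * (n * E)" by simp
      then have "t1 + t \<le> 65 * (n * E)"
        using conjunct1[OF 1] E_ge by linarith
      \<comment> \<open>As \<open>r >= 2\<close>, the inner loop has run at least once and row
        \<open>r\<close> is filled.\<close>
      moreover have "(1 \<noteq> r) = True" using r by simp
      with I have "table r True g'" by (simp only:)
      then have "table (Suc r) False g'"
        using r by (intro table_Suc)
      ultimately show "?Q (t1 + t) g'"
        using I by simp
    qed (use 1 g1 r in \<open>simp_all add: one_ereal_def\<close>)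
  qed
  then show "run (reset_sums;; FOR ''l'' = Var ''r'' \<^bold>- Const 1 DOWNTO Const 1 DO ?body) ?Q g"
    unfolding wp_Seq[of _ _ reset_sums] .
next
  fix t g
  assume "t \<le> nops (Const 2) + nops (Var ''n'' \<^bold>+ Const 1) + 1 +
      (n + 2 - 2) * (65 * (n * E) + nops (Var ''n'' \<^bold>+ Const 1) + 2)" and tab: "table (n + 2) False g"
  then have "t \<le> 2 + n * (65 * (n * E) + 3)" by (simp add: algebra_simps)
  also have "n * (65 * (n * E) + 3) \<le> (65 + 3) * (n * (n * E))"
    using E_ge by (intro loop_bound) simp_all
  finally have "t \<le> 2 + 68 * (n * (n * E))" by simp
  moreover have "1 \<le> n * (n * E)"
    using mult_le_mono[OF n_pos E_ge(6)] by simp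
  ultimately show "t \<le> 70 * (n * (n * E)) \<and> table (n + 2) False g"
    using tab by linarith
qed (use assms in \<open>simp_all add: table_def inputD(1) one_ereal_def\<close>)


section \<open>Backtracking and output\<close>

text \<open>\<open>d\<close> is a ghost sequence of the visited nodes, from right to left. It starts
  at \<open>n + 1\<close>, which is not a partition point, hence the shift by one; the
  \<open>q\<close>-th interval is \<open>[d (Suc q), d q)\<close>.\<close>

definition path :: "nat \<Rightarrow> (nat \<Rightarrow> nat) \<Rightarrow> heap \<Rightarrow> bool" where
  "path N d h \<longleftrightarrow> input h \<and> h (Loc ''num'' []) = ereal (real N) \<and> d 0 = n + 1 \<and>
     (\<forall>q<N. 1 \<le> d (Suc q) \<and> d (Suc q) < d q \<and> h (Loc ''Bhat'' [q]) = ereal (real (d (Suc q))))"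

text \<open>A strictly decreasing sequence of positive integers from \<open>n + 1\<close> has at
  most \<open>n\<close> steps. This bounds the number of partition points and keeps the indices of
  \<open>Bhat\<close> within the allotted cells.\<close>

lemma path_bound: "path N d h \<Longrightarrow> q \<le> N \<Longrightarrow> 1 \<le> d q \<and> q + d q \<le> n + 1"
proof (induction q)
  case 0
  then show ?case by (simp add: path_def)
next
  case (Suc q)
  from Suc.prems have "1 \<le> d (Suc q)" "d (Suc q) < d q"
    by (simp_all add: path_def)
  with Suc show ?case by simp
qed

lemma path_unchanged:
  assumes "path N d h" and "unchanged M h g"
    and "M \<inter> {''n'', ''p'', ''lambda'', ''zeta'', ''y'', ''X'', ''num'', ''Bhat''} = {}"
  shows "path N d g"
proof -
  have "input g"
    using assms(1,3) by (intro input_unchanged[OF _ assms(2)]) (simp_all add: path_def)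
  moreover have "''num'' \<notin> M" "''Bhat'' \<notin> M"
    using assms(3) by simp_all
  ultimately show ?thesis
    using assms(1) by (simp add: path_def unchangedD[OF assms(2)])
qed

lemma path_update [simp]:
  assumes "x \<notin> {''n'', ''p'', ''lambda'', ''zeta'', ''y'', ''X'', ''num'', ''Bhat''}"
  shows "path N d (h(Loc x is := v)) \<longleftrightarrow> path N d h"
  by (rule update_iff, rule path_unchanged, assumption+) (use assms in blast)

lemma run_backtrack:
  assumes "table (n + 2) False h"
  shows "run backtrack (\<lambda>t g. t \<le> 4 * n \<and> (\<exists>N d. 1 \<le> N \<and> path N d g)) h"
proof -
  let ?b = "Less (Const 1) (Var ''k'')"
  let ?body = "''h'' ::= Cell ''ptr'' [Var ''k''];;
       ''Bhat''\<^bold>[[Var ''num'']\<^bold>] ::= Var ''h'';;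
       ''num'' ::= Var ''num'' \<^bold>+ Const 1;;
       ''k'' ::= Var ''h''"
  \<comment> \<open>The variant is the distance of the current node \<open>d N\<close> from node 1,
    initially \<open>n\<close>.\<close>
  define J where "J m g \<longleftrightarrow> (\<forall>k\<in>{2..<n + 2}. \<exists>l\<in>{1..<k}. g (Loc ''ptr'' [k]) = ereal (real l)) \<and>
      (\<exists>N d. path N d g \<and> g (Loc ''k'' []) = ereal (real (d N)) \<and> m = d N - 1)" for m g
  have "run (WHILE ?b DO ?body) (\<lambda>t g. t \<le> cond_ops ?b + n * (cond_ops ?b + 1) \<and> \<not> holds ?b g \<and> (\<exists>m. J m g))
      (h(Loc ''k'' [] := ereal (real (n + 1))))"
  proof (rule wp_While)
    fix m g
    assume "J m g" and b: "holds ?b g"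
    then obtain N d where ptr: "\<forall>k\<in>{2..<n + 2}. \<exists>l\<in>{1..<k}. g (Loc ''ptr'' [k]) = ereal (real l)"
      and path: "path N d g" and k: "g (Loc ''k'' []) = ereal (real (d N))" and m: "m = d N - 1"
      unfolding J_def by blast
    have N: "2 \<le> d N" "N + d N \<le> n + 1"
      using b k path_bound[OF path, of N] by (simp_all add: one_ereal_def)
    then have "d N \<in> {2..<n + 2}" by simp
    with ptr obtain l where l: "1 \<le> l" "l < d N" "g (Loc ''ptr'' [d N]) = ereal (real l)"
      by force
    have num: "g (Loc ''num'' []) = ereal (real N)"
      using path by (simp add: path_def)
    let ?g = "g(Loc ''h'' [] := ereal (real l), Loc ''Bhat'' [N] := ereal (real l),
        Loc ''num'' [] := ereal (real (Suc N)), Loc ''k'' [] := ereal (real l))"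
    \<comment> \<open>The node just read from \<open>ptr\<close> extends the ghost sequence.\<close>
    have "path (Suc N) (d(Suc N := l)) ?g"
      using path l by (simp add: path_def less_Suc_eq)
    then have "J (l - 1) ?g"
      unfolding J_def using ptr by (intro conjI exI[of _ "Suc N"] exI[of _ "d(Suc N := l)"]) simp_all
    moreover have "l - 1 < m" using l m by simp
    ultimately show "run ?body (\<lambda>t g'. t \<le> 1 \<and> (\<exists>m'<m. J m' g')) g"
      using k num l N by (auto simp: one_ereal_def add.commute)
  next
    show "J n (h(Loc ''k'' [] := ereal (real (n + 1))))"
      using assms unfolding J_def table_def path_def
      by (intro conjI exI[of _ 0] exI[of _ "\<lambda>_. n + 1"]) (simp_all add: zero_ereal_def)
  qed simp
  then have "run (WHILE ?b DO ?body) (\<lambda>t g. 1 + t \<le> 4 * n \<and> (\<exists>N d. 1 \<le> N \<and> path N d g))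
      (h(Loc ''k'' [] := ereal (real (n + 1))))"
  proof (rule wp_mono)
    fix t g
    assume *: "t \<le> cond_ops ?b + n * (cond_ops ?b + 1) \<and> \<not> holds ?b g \<and> (\<exists>m. J m g)"
    then obtain N d where path: "path N d g" and k: "g (Loc ''k'' []) = ereal (real (d N))"
      unfolding J_def by blast
    from * k have "d N \<le> 1" by (simp add: one_ereal_def)
    then have "1 \<le> N"
      using path n_pos by (cases N) (simp_all add: path_def)
    then show "1 + t \<le> 4 * n \<and> (\<exists>N d. 1 \<le> N \<and> path N d g)"
      using path * n_pos by auto
  qed
  moreover have "h (Loc ''n'' []) = ereal (real n)"
    using assms by (simp add: table_def inputD(1))
  ultimately show ?thesis
    unfolding backtrack_def wp_Seq[of _ _ "''k'' ::= _"] wp_Assign[of _ _ "''k''" "[]" "_ \<^bold>+ _"]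
    by (simp add: one_ereal_def add.commute)
qed

section \<open>Recomputation and output of the estimators\<close>

lemma run_print_estimate:
  assumes "input h"
  shows "run (FOR ''i'' = Const 0 TO Var ''p'' \<^bold>- Const 1 DO PRINT (Cell ''beta'' [Var ''i'']))
    (\<lambda>t g. t \<le> 2 + 3 * p \<and> unchanged {''i''} h g) h"
proof (rule wp_For[where lo = 0 and hi = p and T = 0 and I = "\<lambda>_. unchanged {''i''} h"])
  fix i g
  assume "unchanged {''i''} h g"
  then show "eval (Var ''p'' \<^bold>- Const 1) g = ereal (real p - 1)"
    using inputD(2)[OF assms] by (simp add: unchangedD one_ereal_def)
qed (simp_all add: zero_ereal_def)

text \<open>The interval is rebuilt from its right end downwards, as in the dynamic programme, so
  \<open>run_update_sums\<close> supplies the exact sums for the solver call. Bounding its length by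
  \<open>n\<close> produces the factor \<open>n\<close> before \<open>E\<close>.\<close>

lemma run_refit:
  assumes path: "path N d h" and q: "q < N"
    and k: "h (Loc ''k'' []) = ereal (real (d q))" and gq: "h (Loc ''q'' []) = ereal (real q)"
  shows "run (''h'' ::= Cell ''Bhat'' [Var ''q''];;
       reset_sums;;
       FOR ''l'' = Var ''k'' \<^bold>- Const 1 DOWNTO Var ''h'' DO update_sums;;
       ''m'' ::= Var ''k'' \<^bold>- Var ''h'';;
       lasso_step;;
       FOR ''i'' = Const 0 TO Var ''p'' \<^bold>- Const 1 DO PRINT (Cell ''beta'' [Var ''i'']);;
       ''k'' ::= Var ''h'')
    (\<lambda>t g. t \<le> 40 * (n * E) \<and> path N d g \<and> g (Loc ''k'' []) = ereal (real (d (Suc q))) \<and>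
      g (Loc ''q'' []) = ereal (real q)) h"
    (is "run (_;; _;; ?sum;; ?m;; _;; ?print;; ?k) ?Q h")
proof -
  \<comment> \<open>The part of the state that survives resetting, summation and fit;
    \<open>h\<close> keeps the next node until \<open>k\<close> is overwritten.\<close>
  define St where "St g \<longleftrightarrow> path N d g \<and> g (Loc ''k'' []) = ereal (real (d q)) \<and>
      g (Loc ''q'' []) = ereal (real q) \<and> g (Loc ''h'' []) = ereal (real (d (Suc q)))" for g
  have St_unchanged: "St g'" if "St g" "unchanged {''i'', ''j'', ''V'', ''M'', ''beta''} g g'" for g g'
    using that path_unchanged[of N d g _ g'] by (simp add: St_def unchangedD)
  have St_input: "input g" if "St g" for g
    using that by (simp add: St_def path_def)
  have St_upd: "St (g(Loc x [] := v)) \<longleftrightarrow> St g" if "x \<in> {''l'', ''m''}" for g x v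
    using that by (elim insertE emptyE) (simp_all add: St_def)
  have d: "1 \<le> d (Suc q)" "d (Suc q) < d q" "d q \<le> n + 1"
    using path q path_bound[OF path, of q] by (simp_all add: path_def)
  have k: "run ?k (\<lambda>t. ?Q (t1 + (t2 + (1 + (t3 + (t4 + t)))))) g"
    if "St g" "t1 \<le> 14 * (p * p)" "t2 \<le> 18 * (n * E)" "t3 \<le> Lasso p" "t4 \<le> 2 + 3 * p" for g t1 t2 t3 t4
  proof -
    \<comment> \<open>In units of \<open>n * E\<close> the terms are at most 14, 18, 1, 1 and 2 + 3,
      in total 39.\<close>
    have "t1 + (t2 + (1 + (t3 + t4))) \<le> 40 * (n * E)"
      using that E_ge unfolding E_def[symmetric] by linarith
    then show ?thesis using that(1) by (simp add: St_def)
  qed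
  have print: "run ?print (\<lambda>t4. run ?k (\<lambda>t. ?Q (t1 + (t2 + (1 + (t3 + (t4 + t))))))) g"
    if St: "St g" "t1 \<le> 14 * (p * p)" "t2 \<le> 18 * (n * E)" "t3 \<le> Lasso p" for g t1 t2 t3
  proof (rule wp_mono[OF run_print_estimate[OF St_input[OF St(1)]]])
    fix t4 g'
    assume 4: "t4 \<le> 2 + 3 * p \<and> unchanged {''i''} g g'"
    then have "St g'"
      using unchanged_mono[of "{''i''}" g g'] by (intro St_unchanged[OF St(1)]) simp
    then show "run ?k (\<lambda>t. ?Q (t1 + (t2 + (1 + (t3 + (t4 + t)))))) g'"
      using 4 St by (intro k) simp_all
  qed
  have lasso: "run lasso_step (\<lambda>t3. run ?print (\<lambda>t4. run ?k (\<lambda>t. ?Q (t1 + (t2 + (1 + (t3 + (t4 + t)))))))) g"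
    if St: "St g" "t1 \<le> 14 * (p * p)" "t2 \<le> 18 * (n * E)"
      and "stores_sums {d (Suc q)..<d q} g" "g (Loc ''m'' []) = ereal (real (d q - d (Suc q)))" for g t1 t2
  proof (rule wp_mono[OF run_lasso_step[OF St_input[OF St(1)] d that(5,4)]])
    fix t3 g'
    assume 3: "t3 \<le> Lasso p \<and> unchanged {''beta''} g g' \<and> (\<forall>i<p. is_real (g' (Loc ''beta'' [i])))"
    then have "St g'"
      using unchanged_mono[of "{''beta''}" g g'] by (intro St_unchanged[OF St(1)]) simp
    then show "run ?print (\<lambda>t4. run ?k (\<lambda>t. ?Q (t1 + (t2 + (1 + (t3 + (t4 + t))))))) g'"
      using 3 St by (intro print) simp_all
  qed
  have m: "run ?m (\<lambda>tm. run lasso_step (\<lambda>t3. run ?print (\<lambda>t4. run ?k (\<lambda>t. ?Q (t1 + (t2 + (tm + (t3 + (t4 + t))))))))) g"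
    if "St g" "t1 \<le> 14 * (p * p)" "t2 \<le> 18 * (n * E)" "stores_sums {d (Suc q)..<d q} g" for g t1 t2
  proof -
    let ?g = "g(Loc ''m'' [] := ereal (real (d q - d (Suc q))))"
    have "run lasso_step (\<lambda>t3. run ?print (\<lambda>t4. run ?k (\<lambda>t. ?Q (t1 + (t2 + (1 + (t3 + (t4 + t)))))))) ?g"
      using that by (intro lasso) (simp_all add: St_upd)
    moreover have "eval (Var ''k'' \<^bold>- Var ''h'') g = ereal (real (d q - d (Suc q)))"
      using that(1) d by (simp add: St_def of_nat_diff)
    ultimately show ?thesis
      unfolding wp_Assign[of _ _ "''m''"] by (simp del: wp_Assign eval.simps)
  qed
  have sum: "run ?sum (\<lambda>t2. run ?m (\<lambda>tm. run lasso_step (\<lambda>t3. run ?print (\<lambda>t4. run ?k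
      (\<lambda>t. ?Q (t1 + (t2 + (tm + (t3 + (t4 + t)))))))))) g"
    if "St g" "t1 \<le> 14 * (p * p)" "stores_sums {} g" for g t1
  proof (rule wp_ForDown[where lo = "d (Suc q)" and hi = "d q" and T = "14 * E"
        and I = "\<lambda>s g. St g \<and> stores_sums {s..<d q} g"])
    fix l g'
    assume l: "d (Suc q) \<le> l" "l < d q" and I: "St g' \<and> stores_sums {Suc l..<d q} g'"
      and gl: "g' (Loc ''l'' []) = ereal (real l)"
    have "1 \<le> l" using d l by linarith
    have "input g'" using I St_input by blast
    show "run update_sums (\<lambda>t g. t \<le> 14 * E \<and> g (Loc ''l'' []) = ereal (real l) \<and>
        St (g(Loc ''l'' [] := ereal (real l - 1))) \<and>
        stores_sums {l..<d q} (g(Loc ''l'' [] := ereal (real l - 1)))) g'"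
    proof (rule wp_mono[OF run_update_sums[OF \<open>input g'\<close> \<open>1 \<le> l\<close> l(2) d(3) gl]])
      fix t g
      assume *: "t \<le> 14 * (p * p) \<and> unchanged {''i'', ''j'', ''V'', ''M''} g' g \<and> stores_sums {l..<d q} g"
      then have U: "unchanged {''i'', ''j'', ''V'', ''M''} g' g" by blast
      have "St g"
        using I unchanged_mono[OF U] by (intro St_unchanged[of g' g]) simp_all
      moreover have "g (Loc ''l'' []) = ereal (real l)"
        using gl by (simp add: unchangedD[OF U])
      moreover have "t \<le> 14 * E"
        using conjunct1[OF *] E_ge by linarith
      ultimately show "t \<le> 14 * E \<and> g (Loc ''l'' []) = ereal (real l) \<and>
        St (g(Loc ''l'' [] := ereal (real l - 1))) \<and>
        stores_sums {l..<d q} (g(Loc ''l'' [] := ereal (real l - 1)))"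
        using * by (simp add: St_upd)
    qed (use I in simp)
  next
    fix t g'
    assume t: "t \<le> nops (Var ''k'' \<^bold>- Const 1) + nops (Var ''h'') + 1 +
        (d q - d (Suc q)) * (14 * E + nops (Var ''h'') + 2)"
      and I: "St g' \<and> stores_sums {d (Suc q)..<d q} g'"
    have "t \<le> 2 + (d q - d (Suc q)) * (14 * E + 2)"
      using t by simp
    also have "(d q - d (Suc q)) * (14 * E + 2) \<le> (14 + 2) * (n * E)"
      using d E_ge(1) by (intro loop_bound) simp_all
    finally have "t \<le> 2 + 16 * (n * E)" by simp
    then have "t \<le> 18 * (n * E)"
      using E_ge by linarith
    then show "run ?m (\<lambda>tm. run lasso_step (\<lambda>t3. run ?print (\<lambda>t4. run ?k
      (\<lambda>ta. ?Q (t1 + (t + (tm + (t3 + (t4 + ta))))))))) g'"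
      using I that by (intro m) simp_all
  qed (use that d in \<open>simp_all add: St_upd, simp_all add: St_def one_ereal_def\<close>)
  let ?h = "h(Loc ''h'' [] := ereal (real (d (Suc q))))"
  have St: "St ?h"
    using assms by (simp add: St_def)
  have "run reset_sums (\<lambda>t1. run ?sum (\<lambda>t2. run ?m (\<lambda>tm. run lasso_step (\<lambda>t3. run ?print (\<lambda>t4. run ?k
      (\<lambda>t. ?Q (t1 + (t2 + (tm + (t3 + (t4 + t))))))))))) ?h"
  proof (rule wp_mono[OF run_reset_sums[OF St_input[OF St]]])
    fix t1 g
    assume 1: "t1 \<le> 14 * (p * p) \<and> unchanged {''i'', ''j'', ''V'', ''M''} ?h g \<and> stores_sums {} g"
    then have U: "unchanged {''i'', ''j'', ''V'', ''M''} ?h g" by blast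
    have "St g"
      using unchanged_mono[OF U] by (intro St_unchanged[OF St]) simp
    then show "run ?sum (\<lambda>t2. run ?m (\<lambda>tm. run lasso_step (\<lambda>t3. run ?print (\<lambda>t4. run ?k
      (\<lambda>t. ?Q (t1 + (t2 + (tm + (t3 + (t4 + t)))))))))) g"
      using 1 by (intro sum) simp_all
  qed
  moreover have "h (Loc ''Bhat'' [q]) = ereal (real (d (Suc q)))"
    using path q by (simp add: path_def)
  ultimately show ?thesis
    unfolding wp_Seq wp_Assign[of _ _ "''h''"] using gq by (simp del: wp_Assign)
qed

text \<open>At most \<open>n\<close> intervals at \<open>40 * (n * E)\<close> each, plus a linear
  cost for the points, stay within the order of the dynamic programme.\<close>

lemma run_print_result:
  assumes N: "1 \<le> N" and path: "path N d h"
  shows "run print_result (\<lambda>t g. t \<le> 60 * (n * (n * E))) h"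
proof -
  have Nn: "N \<le> n"
    using path_bound[OF path, of N] by simp
  have num: "eval (Var ''num'' \<^bold>- Const 1) g = ereal (real N - 1)" if "path N d g" for g
    using that by (simp add: path_def one_ereal_def)
  let ?points = "FOR ''q'' = Const 0 TO Var ''num'' \<^bold>- Const 1 DO PRINT (Cell ''Bhat'' [Var ''q''])"
  let ?body = "''h'' ::= Cell ''Bhat'' [Var ''q''];;
       reset_sums;;
       FOR ''l'' = Var ''k'' \<^bold>- Const 1 DOWNTO Var ''h'' DO update_sums;;
       ''m'' ::= Var ''k'' \<^bold>- Var ''h'';;
       lasso_step;;
       FOR ''i'' = Const 0 TO Var ''p'' \<^bold>- Const 1 DO PRINT (Cell ''beta'' [Var ''i'']);;
       ''k'' ::= Var ''h''"
  let ?estimators = "FOR ''q'' = Const 0 TO Var ''num'' \<^bold>- Const 1 DO (?body)"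
  have estimators: "run ?estimators (\<lambda>t g. t \<le> 2 + 43 * (n * (n * E))) g"
    if "path N d g" "g (Loc ''k'' []) = ereal (real (d 0))" for g
  proof (rule wp_For[where lo = 0 and hi = N and T = "40 * (n * E)"
        and I = "\<lambda>q g. path N d g \<and> g (Loc ''k'' []) = ereal (real (d q))"])
    fix q g'
    assume "q < N" "path N d g' \<and> g' (Loc ''k'' []) = ereal (real (d q))" "g' (Loc ''q'' []) = ereal (real q)"
    then have "run ?body (\<lambda>t g. t \<le> 40 * (n * E) \<and> path N d g \<and> g (Loc ''k'' []) = ereal (real (d (Suc q))) \<and>
      g (Loc ''q'' []) = ereal (real q)) g'"
      by (intro run_refit) simp_all
    then show "run ?body (\<lambda>t g'. t \<le> 40 * (n * E) \<and> g' (Loc ''q'' []) = ereal (real q) \<and>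
          path N d (g'(Loc ''q'' [] := ereal (real (Suc q)))) \<and>
          (g'(Loc ''q'' [] := ereal (real (Suc q)))) (Loc ''k'' []) = ereal (real (d (Suc q)))) g'"
      by (rule wp_mono) simp
  next
    fix t g
    assume "t \<le> nops (Const 0) + nops (Var ''num'' \<^bold>- Const 1) + 1 +
        (N - 0) * (40 * (n * E) + nops (Var ''num'' \<^bold>- Const 1) + 2)"
    then have "t \<le> 2 + N * (40 * (n * E) + 3)" by (simp add: algebra_simps)
    also have "N * (40 * (n * E) + 3) \<le> (40 + 3) * (n * (n * E))"
      using Nn E_ge(6) by (rule loop_bound)
    finally show "t \<le> 2 + 43 * (n * (n * E))" by simp
  qed (use that num in \<open>simp_all add: zero_ereal_def del: eval.simps(4)\<close>)
  have "n * 1 \<le> n * (n * E)" "1 * 1 \<le> n * (n * E)"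
    using n_pos E_ge(6) by (intro mult_le_mono; simp)+
  then have n: "n \<le> n * (n * E)" "1 \<le> n * (n * E)"
    by simp_all
  have "run ?points (\<lambda>t1. run (''k'' ::= Var ''n'' \<^bold>+ Const 1) (\<lambda>tk. run ?estimators
      (\<lambda>t2 g. t1 + (tk + t2) \<le> 60 * (n * (n * E))))) h"
  proof (rule wp_For[where lo = 0 and hi = N and T = 0 and I = "\<lambda>_. path N d"])
    fix t1 g
    assume t1: "t1 \<le> nops (Const 0) + nops (Var ''num'' \<^bold>- Const 1) + 1 +
        (N - 0) * (0 + nops (Var ''num'' \<^bold>- Const 1) + 2)" and g: "path N d g"
    then have "t1 \<le> 2 + 3 * n" using Nn by simp
    moreover have "path N d (g(Loc ''k'' [] := ereal (real (n + 1))))" "d 0 = n + 1"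
      using g by (simp_all add: path_def)
    then have "run ?estimators (\<lambda>t g. t \<le> 2 + 43 * (n * (n * E))) (g(Loc ''k'' [] := ereal (real (n + 1))))"
      by (intro estimators) simp_all
    ultimately have "run ?estimators (\<lambda>t2 g. t1 + (1 + t2) \<le> 60 * (n * (n * E)))
        (g(Loc ''k'' [] := ereal (real (n + 1))))"
      using n by (elim wp_mono) linarith
    moreover have "eval (Var ''n'' \<^bold>+ Const 1) g = ereal (real (n + 1))"
      using g by (simp add: path_def inputD(1) one_ereal_def)
    ultimately show "run (''k'' ::= Var ''n'' \<^bold>+ Const 1) (\<lambda>tk. run ?estimators
      (\<lambda>t2 g. t1 + (tk + t2) \<le> 60 * (n * (n * E)))) g"
      unfolding wp_Assign[of _ _ "''k''"] by (simp del: wp_Assign eval.simps)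
  qed (use path num in \<open>simp_all add: zero_ereal_def del: eval.simps(4)\<close>)
  then show ?thesis
    unfolding print_result_def wp_Seq[of _ _ "PRINT _"] wp_PRINT wp_Seq[of _ _ ?points]
      wp_Seq[of _ _ "''k'' ::= _"]
    by (simp del: wp_Assign)
qed

section \<open>Total cost\<close>

lemma run_DPDU:
  assumes "input h"
  shows "run DPDU (\<lambda>t g. t \<le> 150 * (n * (n * E))) h"
proof -
  have "n * 1 \<le> n * (n * E)"
    using E_ge(6) by (rule mult_le_mono2)
  then have n: "n \<le> n * (n * E)" by simp
  show ?thesis
    unfolding DPDU_def wp_Seq
  proof (rule wp_mono[OF run_dp_init[OF assms]], elim conjE)
    fix t1 g1 assume 1: "t1 \<le> 9 * n" "table 2 False g1"
    show "run dp_loop (\<lambda>t2. run backtrack (\<lambda>t3. run print_result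
        (\<lambda>t4 g. t1 + (t2 + (t3 + t4)) \<le> 150 * (n * (n * E))))) g1"
    proof (rule wp_mono[OF run_dp_loop[OF 1(2)]], elim conjE)
      fix t2 g2 assume 2: "t2 \<le> 70 * (n * (n * E))" "table (n + 2) False g2"
      show "run backtrack (\<lambda>t3. run print_result
        (\<lambda>t4 g. t1 + (t2 + (t3 + t4)) \<le> 150 * (n * (n * E)))) g2"
      proof (rule wp_mono[OF run_backtrack[OF 2(2)]], elim conjE exE)
        fix t3 g3 N d assume 3: "t3 \<le> 4 * n" "1 \<le> N" "path N d g3"
        show "run print_result (\<lambda>t4 g. t1 + (t2 + (t3 + t4)) \<le> 150 * (n * (n * E))) g3"
          \<comment> \<open>The four phases contribute 9, 70, 4 and 60, in total 143.\<close>
          by (rule wp_mono[OF run_print_result[OF 3(2,3)]]) (use 1(1) 2(1) 3(1) n in linarith)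
      qed
    qed
  qed
qed

end

theorem lemma1:
  fixes K :: nat
  shows "\<exists>C::real. \<forall>(n::nat) (p::nat) (y::nat \<Rightarrow> real) (X::nat \<Rightarrow> real vec) (lam::real) (zeta::real)
           (S::solver) (Lasso::nat \<Rightarrow> nat) (h::heap).
         1 \<le> n \<longrightarrow> 1 \<le> p \<longrightarrow> (\<forall>t\<in>{1..n}. X t \<in> carrier_vec p) \<longrightarrow> 0 < lam \<longrightarrow> 0 < zeta \<longrightarrow>
         lasso_procedure S Lasso K \<longrightarrow> input_heap n p y X lam zeta h \<longrightarrow>
         (\<exists>h' out t W. exec S DPDU h h' out t W
            \<and> finite W
            \<and> real (card W) \<le> C * (real n + (real p)\<^sup>2)
            \<and> real t \<le> C * ((real n)\<^sup>2 * (real p)\<^sup>2 + (real n)\<^sup>2 * real (Lasso p)))"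
proof (intro exI[of _ "real (150 + K)"] allI impI)
  fix n p :: nat and y X lam zeta S Lasso h
  assume asm: "1 \<le> n" "1 \<le> p" "\<forall>t\<in>{1..n}. X t \<in> carrier_vec p" "0 < lam" "0 < zeta"
    "lasso_procedure S Lasso K" and h: "input_heap n p y X lam zeta h"
  interpret dpdu n p K y X lam zeta S Lasso
    using asm by unfold_locales
  from run_DPDU[OF h] obtain h' out t W where ex: "exec S DPDU h h' out t W"
    and W: "W \<subseteq> cells n p (K * p\<^sup>2)" and t: "t \<le> 150 * (n * (n * E))"
    unfolding wp_def by blast
  have "finite W"
    using W finite_cells by (rule finite_subset)
  have "card W \<le> 27 + 2 * p + 3 * n + p * p + K * p\<^sup>2"
    using card_mono[OF finite_cells W] card_cells by (rule order.trans)
  also have "\<dots> \<le> 27 * n + 2 * (p * p) + 3 * n + p * p + K * (n + p * p)"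
    using asm(1,2) by (intro add_mono mult_le_mono) (simp_all add: power2_eq_square)
  also have "\<dots> \<le> (150 + K) * (n + p * p)"
    by (simp add: algebra_simps)
  finally have "real (card W) \<le> real ((150 + K) * (n + p * p))"
    by (simp only: of_nat_le_iff)
  moreover have "t \<le> (150 + K) * (n * (n * E))"
    using t by (rule order.trans) simp
  then have "real t \<le> real ((150 + K) * (n * (n * E)))"
    by (simp only: of_nat_le_iff)
  ultimately show "\<exists>h' out t W. exec S DPDU h h' out t W \<and> finite W
      \<and> real (card W) \<le> real (150 + K) * (real n + (real p)\<^sup>2)
      \<and> real t \<le> real (150 + K) * ((real n)\<^sup>2 * (real p)\<^sup>2 + (real n)\<^sup>2 * real (Lasso p))"
    using ex \<open>finite W\<close>
    by (intro exI[of _ h'] exI[of _ out] exI[of _ t] exI[of _ W])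
      (simp add: E_def power2_eq_square algebra_simps)
qed

end
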